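(* Let $\mathcal{H}$ (system) and $\mathcal{M}$ (memory) be Hilbert spaces, let $\{|l\rangle\}_l$ be an orthonormal basis of $\mathcal{M}$, let $V_l$ be unitary operators on $\mathcal{H}$, and let $U^{\rm ctrl}=\sum_l |l\rangle\langle l|_{\mathcal{M}}\otimes V_l$ be the corresponding controlled unitary interaction on $\mathcal{M}\otimes\mathcal{H}$. Then the memory device induced by $U^{\rm ctrl}$ is indistinguishable from a memoryless unitary device. That is: for every initial memory state $\xi\in\mathcal{S}(\mathcal{M})$, every number of uses $n\ge 1$, every joint input state $\varrho^{(n)}\in\mathcal{S}(\mathcal{H}^{\otimes n})$ and every effect $E$ on $\mathcal{H}^{\otimes n}$ such that $$\mathrm{tr}\big[E\,\mathcal{E}^{(n)}(\varrho^{(n)})\big]>0,$$ where $\mathcal{E}^{(n)}$ is the $n$-use channel of the memory device $(U^{\rm ctrl},\xi)$, there exists an index $l$ such that $$\mathrm{tr}\big[E\,V_l^{\otimes n}\varrho^{(n)}(V_l^{\dagger})^{\otimes n}\big]>0 .$$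
   Context: $\mathcal{S}(\mathcal{K})$ denotes the set of density operators (positive operators of unit trace) on a Hilbert space $\mathcal{K}$. An effect is an operator $E$ with $0\le E\le I$. Memory device: given a unitary operator $U$ on $\mathcal{M}\otimes\mathcal{H}$ and an initial memory state $\xi$, the $n$-use channel is $$\mathcal{E}^{(n)}(\varrho^{(n)})=\mathrm{tr}_{\mathcal{M}}\big[U_n\cdots U_1(\xi\otimes\varrho^{(n)})U_1^\dagger\cdots U_n^\dagger\big],$$ where $\varrho^{(n)}$ is a state of $n$ copies of $\mathcal{H}$ and $U_k$ acts as $U$ on the memory and the $k$-th copy of $\mathcal{H}$ and as the identity on the other copies. The memory is experimentally inaccessible and only one copy of the device (hence of $\xi$) is available, so an experiment with $n$ uses consists of a single outcome, i.e. a single observed effect $E$ on the $n$ outputs (it cannot be repeated to accumulate statistics). A memoryless unitary device with unitary $V$ on $\mathcal{H}$ acts on $n$ inputs as $\varrho^{(n)}\mapsto V^{\otimes n}\varrho^{(n)}(V^\dagger)^{\otimes n}$. "Indistinguishable" means that no observable single outcome can exclude every memoryless unitary device: any outcome $E$ that can occur (with positive probability) for the memory device can, for the same input state, also occur with positive probability for a memoryless unitary device with one of the unitaries $V_l$. *)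

theory Defs
  imports "HOL-Analysis.Analysis"
begin

section \<open>Complex Hilbert spaces\<close>

text \<open>
  A complex Hilbert space is a complete real inner product space with a complex scalar
  multiplication extending the real one and a sesquilinear form (linear in the second argument)
  whose real part is the real inner product. Positive definiteness and the norm come from
  \<^class>\<open>real_inner\<close>. There is no restriction on the dimension.
\<close>

class complex_hilbert_space = real_inner + complete_space +
  fixes scaleC :: "complex \<Rightarrow> 'a \<Rightarrow> 'a" (infixr "*\<^sub>C" 75)
    and cinner :: "'a \<Rightarrow> 'a \<Rightarrow> complex"
  assumes scaleC_add_right: "a *\<^sub>C (x + y) = a *\<^sub>C x + a *\<^sub>C y"
    and scaleC_add_left: "(a + b) *\<^sub>C x = a *\<^sub>C x + b *\<^sub>C x"
    and scaleC_scaleC: "a *\<^sub>C (b *\<^sub>C x) = (a * b) *\<^sub>C x"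
    and scaleC_of_real: "complex_of_real r *\<^sub>C x = r *\<^sub>R x"
    and cinner_commute: "cinner x y = cnj (cinner y x)"
    and cinner_add_right: "cinner x (y + z) = cinner x y + cinner x z"
    and cinner_scaleC_right: "cinner x (a *\<^sub>C y) = a * cinner x y"
    and Re_cinner: "Re (cinner x y) = inner x y"

global_interpretation complex_vector:
  vector_space "scaleC :: complex \<Rightarrow> 'a \<Rightarrow> 'a::complex_hilbert_space"
  defines cspan = complex_vector.span
proof
  show "(1::complex) *\<^sub>C x = x" for x :: 'a
    using scaleC_of_real[of 1 x] by simp
qed (simp_all add: scaleC_add_right scaleC_add_left scaleC_scaleC)

definition orthonormal_basis :: "('i \<Rightarrow> 'a::complex_hilbert_space) \<Rightarrow> 'i set \<Rightarrow> bool" where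
  "orthonormal_basis e I \<longleftrightarrow>
     (\<forall>i\<in>I. \<forall>j\<in>I. cinner (e i) (e j) = (if i = j then 1 else 0)) \<and>
     closure (cspan (e ` I)) = UNIV"

text \<open>An arbitrary orthonormal basis, used to write down traces.\<close>

definition some_basis :: "'a::complex_hilbert_space set" where
  "some_basis = (SOME B. orthonormal_basis (\<lambda>b. b) B)"


section \<open>Operators\<close>

definition bounded_clinear :: "('a::complex_hilbert_space \<Rightarrow> 'b::complex_hilbert_space) \<Rightarrow> bool" where
  "bounded_clinear A \<longleftrightarrow> bounded_linear A \<and> (\<forall>c x. A (c *\<^sub>C x) = c *\<^sub>C A x)"

definition cadjoint ::
  "('a::complex_hilbert_space \<Rightarrow> 'b::complex_hilbert_space) \<Rightarrow> 'b \<Rightarrow> 'a" where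
  "cadjoint A = (THE B. \<forall>x y. cinner (B x) y = cinner x (A y))"

definition unitary_op :: "('a::complex_hilbert_space \<Rightarrow> 'a) \<Rightarrow> bool" where
  "unitary_op U \<longleftrightarrow> bounded_clinear U \<and> cadjoint U \<circ> U = id \<and> U \<circ> cadjoint U = id"

text \<open>
  Inequalities between complex numbers are those of \<^theory>\<open>HOL-Library.Complex_Order\<close>:
  \<open>0 \<le> z\<close> and \<open>0 < z\<close> include that \<open>z\<close> is real.
\<close>

definition positive_op :: "('a::complex_hilbert_space \<Rightarrow> 'a) \<Rightarrow> bool" where
  "positive_op A \<longleftrightarrow> bounded_clinear A \<and> (\<forall>x. 0 \<le> cinner x (A x))"

definition effect :: "('a::complex_hilbert_space \<Rightarrow> 'a) \<Rightarrow> bool" where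
  "effect E \<longleftrightarrow> positive_op E \<and> positive_op (\<lambda>x. x - E x)"

text \<open>
  Meaningful for trace class operators, where the value does not depend on the basis. For a
  positive operator that is not trace class the sum is 0, so a positive operator
  of trace 1 is trace class.
\<close>

definition trace_op :: "('a::complex_hilbert_space \<Rightarrow> 'a) \<Rightarrow> complex" where
  "trace_op A = (\<Sum>\<^sub>\<infinity>b\<in>some_basis. cinner b (A b))"

definition density_operator :: "('a::complex_hilbert_space \<Rightarrow> 'a) \<Rightarrow> bool" where
  "density_operator \<rho> \<longleftrightarrow> positive_op \<rho> \<and> trace_op \<rho> = 1"

definition ketbra :: "'a::complex_hilbert_space \<Rightarrow> 'a \<Rightarrow> 'a" where
  "ketbra x = (\<lambda>y. cinner x y *\<^sub>C x)"


section \<open>Hilbert space tensor products\<close>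

text \<open>
  A tensor product is a Hilbert space with a map sending \<open>x, y\<close> to the elementary tensor
  \<open>x \<otimes> y\<close>, such that the inner products of elementary tensors are the products of the inner
  products and the elementary tensors span a dense subspace. These properties determine it up to
  a unique unitary operator. The \<open>n\<close>-fold tensor power is treated in the same way; its factors are
  numbered \<open>0, \<dots>, n - 1\<close>, and the values of the argument at indices \<open>i \<ge> n\<close> are irrelevant.
\<close>

definition is_tensor_product ::
  "('a::complex_hilbert_space \<Rightarrow> 'b::complex_hilbert_space \<Rightarrow> 'c::complex_hilbert_space) \<Rightarrow> bool" where
  "is_tensor_product t \<longleftrightarrow>
     (\<forall>x x' y. t (x + x') y = t x y + t x' y) \<and>
     (\<forall>x y y'. t x (y + y') = t x y + t x y') \<and>
     (\<forall>c x y. t (c *\<^sub>C x) y = c *\<^sub>C t x y) \<and>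
     (\<forall>c x y. t x (c *\<^sub>C y) = c *\<^sub>C t x y) \<and>
     (\<forall>x x' y y'. cinner (t x y) (t x' y') = cinner x x' * cinner y y') \<and>
     closure (cspan (range (\<lambda>(x, y). t x y))) = UNIV"

definition is_tensor_power ::
  "nat \<Rightarrow> ((nat \<Rightarrow> 'a::complex_hilbert_space) \<Rightarrow> 'b::complex_hilbert_space) \<Rightarrow> bool" where
  "is_tensor_power n t \<longleftrightarrow>
     (\<forall>x. \<forall>k<n. \<forall>u v. t (x(k := u + v)) = t (x(k := u)) + t (x(k := v))) \<and>
     (\<forall>x. \<forall>k<n. \<forall>c u. t (x(k := c *\<^sub>C u)) = c *\<^sub>C t (x(k := u))) \<and>
     (\<forall>x y. cinner (t x) (t y) = (\<Prod>i<n. cinner (x i) (y i))) \<and>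
     closure (cspan (range t)) = UNIV"

text \<open>
  \<open>A \<otimes> B\<close> and \<open>A\<^sup>\<otimes>\<^sup>n\<close>; for bounded \<open>A\<close> and \<open>B\<close>
  they exist and are unique because elementary tensors span a dense subspace.
\<close>

definition tensor_op ::
  "('a::complex_hilbert_space \<Rightarrow> 'b::complex_hilbert_space \<Rightarrow> 'c::complex_hilbert_space) \<Rightarrow>
   ('a \<Rightarrow> 'a) \<Rightarrow> ('b \<Rightarrow> 'b) \<Rightarrow> 'c \<Rightarrow> 'c" where
  "tensor_op t A B = (THE W. bounded_clinear W \<and> (\<forall>x y. W (t x y) = t (A x) (B y)))"

definition power_op ::
  "((nat \<Rightarrow> 'a::complex_hilbert_space) \<Rightarrow> 'b::complex_hilbert_space) \<Rightarrow> ('a \<Rightarrow> 'a) \<Rightarrow> 'b \<Rightarrow> 'b" where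
  "power_op t A = (THE W. bounded_clinear W \<and> (\<forall>x. W (t x) = t (\<lambda>i. A (x i))))"

text \<open>
  The partial trace over the first factor: the operator with matrix elements
  \<open>\<langle>x| tr\<^sub>1 T |y\<rangle> = \<Sum>\<^sub>b \<langle>b \<otimes> x| T |b \<otimes> y\<rangle>\<close>, where \<open>b\<close> runs through an orthonormal basis.
  For trace class \<open>T\<close> this exists and does not depend on the basis.
\<close>

definition partial_trace ::
  "('a::complex_hilbert_space \<Rightarrow> 'b::complex_hilbert_space \<Rightarrow> 'c::complex_hilbert_space) \<Rightarrow>
   ('c \<Rightarrow> 'c) \<Rightarrow> 'b \<Rightarrow> 'b" where
  "partial_trace t T = (THE S. bounded_clinear S \<and>
     (\<forall>x y. cinner x (S y) = (\<Sum>\<^sub>\<infinity>b\<in>some_basis. cinner (t b x) (T (t b y)))))"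


section \<open>Memory devices\<close>

text \<open>
  In this section \<open>tMH\<close>, \<open>tn\<close> and \<open>tM\<close> are the maps to elementary tensors of
  \<open>M \<otimes> H\<close>, of the \<open>n\<close>-fold power \<open>H\<^sup>\<otimes>\<^sup>n\<close>, and of \<open>M \<otimes> H\<^sup>\<otimes>\<^sup>n\<close>.
\<close>

text \<open>
  The controlled unitary \<open>\<Sum>\<^sub>l |l\<rangle>\<langle>l| \<otimes> V\<^sub>l\<close>; for infinitely many \<open>l\<close> the sum converges strongly.
\<close>

definition controlled_op ::
  "('m::complex_hilbert_space \<Rightarrow> 'h::complex_hilbert_space \<Rightarrow> 'mh::complex_hilbert_space) \<Rightarrow>
   ('l \<Rightarrow> 'm) \<Rightarrow> 'l set \<Rightarrow> ('l \<Rightarrow> 'h \<Rightarrow> 'h) \<Rightarrow> 'mh \<Rightarrow> 'mh" where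
  "controlled_op tMH e L V = (\<lambda>\<psi>. \<Sum>\<^sub>\<infinity>l\<in>L. tensor_op tMH (ketbra (e l)) (V l) \<psi>)"

text \<open>
  The operator that acts as \<open>U\<close> on the memory and on copy \<open>k\<close> and as the identity on the other
  copies, determined by its matrix elements between product vectors.
\<close>

definition use_op ::
  "('m::complex_hilbert_space \<Rightarrow> 'h::complex_hilbert_space \<Rightarrow> 'mh::complex_hilbert_space) \<Rightarrow>
   ((nat \<Rightarrow> 'h) \<Rightarrow> 'hn::complex_hilbert_space) \<Rightarrow>
   ('m \<Rightarrow> 'hn \<Rightarrow> 'mhn::complex_hilbert_space) \<Rightarrow>
   nat \<Rightarrow> ('mh \<Rightarrow> 'mh) \<Rightarrow> nat \<Rightarrow> 'mhn \<Rightarrow> 'mhn" where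
  "use_op tMH tn tM n U k = (THE W. bounded_clinear W \<and>
     (\<forall>m x m' x'. cinner (tM m' (tn x')) (W (tM m (tn x))) =
        cinner (tMH m' (x' k)) (U (tMH m (x k))) * (\<Prod>i\<in>{..<n} - {k}. cinner (x' i) (x i))))"

text \<open>\<open>evolve W n T = W\<^sub>n\<^sub>-\<^sub>1 \<dots> W\<^sub>0 T W\<^sub>0\<^sup>\<dagger> \<dots> W\<^sub>n\<^sub>-\<^sub>1\<^sup>\<dagger>\<close>\<close>

primrec evolve ::
  "(nat \<Rightarrow> 'a::complex_hilbert_space \<Rightarrow> 'a) \<Rightarrow> nat \<Rightarrow> ('a \<Rightarrow> 'a) \<Rightarrow> 'a \<Rightarrow> 'a" where
  "evolve W 0 T = T"
| "evolve W (Suc k) T = W k \<circ> evolve W k T \<circ> cadjoint (W k)"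

definition memory_channel ::
  "('m::complex_hilbert_space \<Rightarrow> 'h::complex_hilbert_space \<Rightarrow> 'mh::complex_hilbert_space) \<Rightarrow>
   ((nat \<Rightarrow> 'h) \<Rightarrow> 'hn::complex_hilbert_space) \<Rightarrow>
   ('m \<Rightarrow> 'hn \<Rightarrow> 'mhn::complex_hilbert_space) \<Rightarrow>
   nat \<Rightarrow> ('mh \<Rightarrow> 'mh) \<Rightarrow> ('m \<Rightarrow> 'm) \<Rightarrow> ('hn \<Rightarrow> 'hn) \<Rightarrow> 'hn \<Rightarrow> 'hn" where
  "memory_channel tMH tn tM n U \<xi> \<rho> =
     partial_trace tM (evolve (use_op tMH tn tM n U) n (tensor_op tM \<xi> \<rho>))"

definition memoryless_channel ::
  "((nat \<Rightarrow> 'h::complex_hilbert_space) \<Rightarrow> 'hn::complex_hilbert_space) \<Rightarrow>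
   ('h \<Rightarrow> 'h) \<Rightarrow> ('hn \<Rightarrow> 'hn) \<Rightarrow> 'hn \<Rightarrow> 'hn" where
  "memoryless_channel tn V \<rho> = power_op tn V \<circ> \<rho> \<circ> power_op tn (cadjoint V)"

end

theory Submission
  imports Defs
begin

text \<open>
  Positive operators of trace 1 are norm convergent sums \<open>\<xi> = \<Sum>\<^sub>i |v\<^sub>i\<rangle>\<langle>v\<^sub>i|\<close> and
  \<open>\<rho> = \<Sum>\<^sub>j |r\<^sub>j\<rangle>\<langle>r\<^sub>j|\<close> with square summable \<open>v\<close> and \<open>r\<close>. The controlled interaction maps
  \<open>|l\<rangle> \<otimes> \<psi>\<close> to \<open>|l\<rangle> \<otimes> V\<^sub>l\<^sup>\<otimes>\<^sup>n \<psi>\<close> after \<open>n\<close> uses; call the resulting operator \<open>F\<close>. The memory device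
  outputs \<open>\<Sum> |s\<rangle>\<langle>s|\<close> over the vectors \<open>s = (\<langle>b| \<otimes> 1) F (v\<^sub>i \<otimes> r\<^sub>j)\<close>, \<open>b\<close> in an orthonormal
  basis of the memory, and the memoryless device with \<open>V\<^sub>l\<close> outputs the sum over \<open>V\<^sub>l\<^sup>\<otimes>\<^sup>n r\<^sub>j\<close>.
  If \<open>E\<close> has probability 0 for every \<open>l\<close>, then \<open>E V\<^sub>l\<^sup>\<otimes>\<^sup>n r\<^sub>j = 0\<close> for all \<open>l\<close> and \<open>j\<close>, because
  \<open>\<langle>x|E|x\<rangle> = 0\<close> forces \<open>E x = 0\<close>. So the bounded linear map \<open>m \<mapsto> E (\<langle>b| \<otimes> 1) F (m \<otimes> r\<^sub>j)\<close>
  vanishes on the basis \<open>|l\<rangle>\<close>, hence everywhere, and \<open>E\<close> has probability 0 for the memory device.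
\<close>

section \<open>Complex inner products and bounded operators\<close>

instance complex_hilbert_space \<subseteq> banach ..

text \<open>With this instance, scalar-valued functionals such as \<open>cinner x\<close> are
  \<open>bounded_clinear\<close> maps too, so the density and summation lemmas below cover
  them.\<close>

instantiation complex :: complex_hilbert_space
begin

definition scaleC_complex :: "complex \<Rightarrow> complex \<Rightarrow> complex" where
  "scaleC_complex a x = a * x"

definition cinner_complex :: "complex \<Rightarrow> complex \<Rightarrow> complex" where
  "cinner_complex x y = cnj x * y"

instance
  by standard
    (auto simp: scaleC_complex_def cinner_complex_def algebra_simps scaleR_conv_of_real inner_complex_def)

end

lemma mult_cnj_self: "z * cnj z = complex_of_real ((cmod z)\<^sup>2)"
  by (simp only: complex_norm_square)

lemma cnj_mult_self: "cnj z * z = complex_of_real ((cmod z)\<^sup>2)"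
  by (simp only: complex_norm_square mult.commute)

lemma cinner_add_left: "cinner (x + y) z = cinner x z + cinner y z"
  by (metis cinner_add_right cinner_commute complex_cnj_add)

lemma cinner_scaleC_left: "cinner (a *\<^sub>C x) y = cnj a * cinner x y"
  by (metis cinner_commute cinner_scaleC_right complex_cnj_mult)

lemma cinner_zero_right [simp]: "cinner x 0 = 0"
  using cinner_add_right[of x 0 0] by simp

lemma cinner_zero_left [simp]: "cinner 0 x = 0"
  using cinner_add_left[of 0 0 x] by simp

lemma cinner_minus_right: "cinner x (- y) = - cinner x y"
  using cinner_add_right[of x y "- y"] by (simp add: eq_neg_iff_add_eq_0 add.commute)

lemma cinner_minus_left: "cinner (- x) y = - cinner x y"
  using cinner_add_left[of x "- x" y] by (simp add: eq_neg_iff_add_eq_0 add.commute)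

lemma cinner_diff_right: "cinner x (y - z) = cinner x y - cinner x z"
  using cinner_add_right[of x y "- z"] by (simp add: cinner_minus_right)

lemma cinner_diff_left: "cinner (x - y) z = cinner x z - cinner y z"
  using cinner_add_left[of x "- y" z] by (simp add: cinner_minus_left)

lemma cinner_sum_right: "cinner x (sum f F) = (\<Sum>i\<in>F. cinner x (f i))"
  by (induction F rule: infinite_finite_induct) (auto simp: cinner_add_right)

lemma cinner_sum_left: "cinner (sum f F) x = (\<Sum>i\<in>F. cinner (f i) x)"
  by (induction F rule: infinite_finite_induct) (auto simp: cinner_add_left)

lemma scaleR_eq_scaleC: "r *\<^sub>R x = complex_of_real r *\<^sub>C x"
  by (simp add: scaleC_of_real)

lemma cinner_scaleR_right: "cinner x (r *\<^sub>R y) = complex_of_real r * cinner x y"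
  by (simp add: scaleR_eq_scaleC cinner_scaleC_right)

lemma cinner_self: "cinner x x = complex_of_real ((norm x)\<^sup>2)"
proof -
  have "Im (cinner x x) = 0"
    using arg_cong[OF cinner_commute[of x x], of Im] by simp
  then show ?thesis
    by (simp add: complex_eq_iff Re_cinner power2_norm_eq_inner)
qed

lemma cinner_self_eq_0 [simp]: "cinner x x = 0 \<longleftrightarrow> x = 0"
  by (simp add: cinner_self)

lemma norm_scaleC: "norm (a *\<^sub>C x) = cmod a * norm x"
proof -
  have "cinner (a *\<^sub>C x) (a *\<^sub>C x) = (a * cnj a) * cinner x x"
    by (simp add: cinner_scaleC_left cinner_scaleC_right mult_ac)
  then have "(norm (a *\<^sub>C x))\<^sup>2 = (cmod a * norm x)\<^sup>2"
    by (simp only: cinner_self mult_cnj_self of_real_mult[symmetric] of_real_eq_iff power_mult_distrib)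
  then show ?thesis
    by (simp add: power2_eq_iff_nonneg)
qed

lemma norm_cinner_le: "cmod (cinner x y) \<le> norm x * norm y"
proof -
  \<comment> \<open>This phase makes \<open>cinner x (u *\<^sub>C y)\<close> real and nonnegative,
    so that the Cauchy-Schwarz inequality of the real inner product applies.\<close>
  define u where "u = cnj (sgn (cinner x y))"
  have "cmod (cinner x y) = Re (cinner x (u *\<^sub>C y))"
  proof (cases "cinner x y = 0")
    case False
    have "u * cinner x y = complex_of_real (cmod (cinner x y))"
      using False unfolding u_def sgn_div_norm
      by (simp add: scaleR_conv_of_real field_simps mult_cnj_self power2_eq_square)
    then show ?thesis
      by (simp add: cinner_scaleC_right)
  qed (simp add: cinner_scaleC_right)
  also have "\<dots> \<le> norm x * norm (u *\<^sub>C y)"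
    unfolding Re_cinner by (rule norm_cauchy_schwarz)
  also have "\<dots> \<le> norm x * norm y"
    unfolding norm_scaleC u_def by (auto simp: norm_sgn intro!: mult_left_mono mult_left_le_one_le)
  finally show ?thesis .
qed

section \<open>Bounded complex-linear maps\<close>

lemma bounded_clinearI:
  assumes "\<And>x y. A (x + y) = A x + A y" "\<And>c x. A (c *\<^sub>C x) = c *\<^sub>C A x"
    "\<And>x. norm (A x) \<le> K * norm x"
  shows "bounded_clinear A"
  unfolding bounded_clinear_def
  by (auto intro!: bounded_linear_intro[where K = K] simp: assms scaleR_eq_scaleC mult.commute)

lemma bounded_clinear_bounded_linear: "bounded_clinear A \<Longrightarrow> bounded_linear A"
  by (simp add: bounded_clinear_def)

lemma bounded_clinear_scaleC: "bounded_clinear A \<Longrightarrow> A (c *\<^sub>C x) = c *\<^sub>C A x"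
  by (simp add: bounded_clinear_def)

lemma bounded_clinear_add: "bounded_clinear A \<Longrightarrow> A (x + y) = A x + A y"
  by (simp add: bounded_clinear_def linear_add bounded_linear.linear)

lemma bounded_clinear_diff: "bounded_clinear A \<Longrightarrow> A (x - y) = A x - A y"
  by (simp add: bounded_clinear_def linear_diff bounded_linear.linear)

lemma bounded_clinear_zero: "bounded_clinear A \<Longrightarrow> A 0 = 0"
  by (simp add: bounded_clinear_def linear_0 bounded_linear.linear)

lemma bounded_clinear_id: "bounded_clinear (\<lambda>x. x)"
  by (simp add: bounded_clinear_def)

lemma bounded_clinear_compose:
  "bounded_clinear A \<Longrightarrow> bounded_clinear B \<Longrightarrow> bounded_clinear (\<lambda>x. A (B x))"
  by (auto simp: bounded_clinear_def intro: bounded_linear_compose)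

lemma bounded_clinear_sub:
  "bounded_clinear A \<Longrightarrow> bounded_clinear B \<Longrightarrow> bounded_clinear (\<lambda>x. A x - B x)"
  by (auto simp: bounded_clinear_def complex_vector.scale_right_diff_distrib intro: bounded_linear_sub)

lemma bounded_clinear_const_scaleC:
  assumes "bounded_clinear A"
  shows "bounded_clinear (\<lambda>x. c *\<^sub>C A x)"
proof -
  obtain K where K: "\<And>x. norm (A x) \<le> norm x * K"
    using bounded_linear.bounded[OF bounded_clinear_bounded_linear[OF assms]] by blast
  show ?thesis
  proof (rule bounded_clinearI[where K = "cmod c * K"])
    show "norm (c *\<^sub>C A x) \<le> cmod c * K * norm x" for x
      using mult_left_mono[OF K, of "cmod c" x] by (simp add: norm_scaleC mult_ac)
  qed (simp_all add: bounded_clinear_add[OF assms] bounded_clinear_scaleC[OF assms]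
      scaleC_add_right scaleC_scaleC mult.commute)
qed

lemma bounded_clinear_cinner: "bounded_clinear (cinner x)"
  by (rule bounded_clinearI[where K = "norm x"])
    (simp_all add: cinner_add_right cinner_scaleC_right scaleC_complex_def norm_cinner_le)

lemma bounded_clinear_scaleC_left: "bounded_clinear (\<lambda>c. c *\<^sub>C x)"
  by (rule bounded_clinearI[where K = "norm x"])
    (simp_all add: scaleC_add_left scaleC_scaleC scaleC_complex_def norm_scaleC)

lemma bounded_clinear_cmult_right: "bounded_clinear (\<lambda>c. c * a :: complex)"
  using bounded_clinear_scaleC_left[of a] by (simp add: scaleC_complex_def)

lemma bounded_clinear_cinner_right:
  "bounded_clinear A \<Longrightarrow> bounded_clinear (\<lambda>y. cinner x (A y))"
  by (rule bounded_clinear_compose[OF bounded_clinear_cinner])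

section \<open>Infinite sums and density arguments\<close>

lemma bounded_clinear_has_sum:
  "bounded_clinear A \<Longrightarrow> (f has_sum s) I \<Longrightarrow> ((\<lambda>i. A (f i)) has_sum A s) I"
  by (rule has_sum_bounded_linear[OF bounded_clinear_bounded_linear])

text \<open>The kernel is a closed subspace containing \<open>S\<close>. Operator identities below
  are reduced to generating vectors in this way.\<close>

lemma bounded_clinear_zero_on_dense:
  assumes "bounded_clinear A" and "closure (cspan S) = UNIV" and "\<And>x. x \<in> S \<Longrightarrow> A x = 0"
  shows "A x = 0"
proof -
  have "A y = 0" if "y \<in> cspan S" for y
    using that
    by (induction rule: complex_vector.span_induct_alt)
      (auto simp: bounded_clinear_zero bounded_clinear_add bounded_clinear_scaleC assms(1,3))
  moreover have "closed {y. A y = 0}"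
    by (intro closed_Collect_eq continuous_intros
        bounded_linear.continuous_on[OF bounded_clinear_bounded_linear[OF assms(1)]] continuous_on_id)
  ultimately have "closure (cspan S) \<subseteq> {y. A y = 0}"
    by (intro closure_minimal) auto
  then show ?thesis
    using assms(2) by auto
qed

lemma bounded_clinear_eq_on_dense:
  assumes "bounded_clinear A" "bounded_clinear B" "closure (cspan S) = UNIV"
    and "\<And>x. x \<in> S \<Longrightarrow> A x = B x"
  shows "A = B"
proof
  show "A x = B x" for x
    using bounded_clinear_zero_on_dense[OF bounded_clinear_sub[OF assms(1,2)] assms(3), of x] assms(4)
    by simp
qed

lemma cinner_ext: "(\<And>x. cinner x y = cinner x z) \<Longrightarrow> y = z"
  by (metis cinner_diff_right cinner_self_eq_0 right_minus_eq)

text \<open>The functional \<open>cinner (y - z)\<close> vanishes on a dense span, hence everywhere,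
  in particular at \<open>y - z\<close> itself.\<close>

lemma cinner_ext_dense:
  assumes "closure (cspan S) = UNIV" "\<And>x. x \<in> S \<Longrightarrow> cinner x y = cinner x z"
  shows "y = z"
proof -
  have "cinner (y - z) x = 0" for x
  proof (rule bounded_clinear_zero_on_dense[OF bounded_clinear_cinner assms(1)])
    fix x assume "x \<in> S"
    then have "cinner x (y - z) = 0"
      by (simp add: cinner_diff_right assms(2))
    then show "cinner (y - z) x = 0"
      by (subst cinner_commute) simp
  qed
  from this[of "y - z"] show ?thesis by simp
qed

section \<open>Orthonormal bases\<close>

lemma norm_sum_orthonormal:
  assumes on: "\<And>i j. i \<in> I \<Longrightarrow> j \<in> I \<Longrightarrow> cinner (e i) (e j) = (if i = j then 1 else 0)"
    and F: "finite F" "F \<subseteq> I"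
  shows "(norm (\<Sum>i\<in>F. c i *\<^sub>C e i))\<^sup>2 = (\<Sum>i\<in>F. (cmod (c i))\<^sup>2)"
proof -
  have "cinner (\<Sum>i\<in>F. c i *\<^sub>C e i) (\<Sum>i\<in>F. c i *\<^sub>C e i)
      = (\<Sum>i\<in>F. \<Sum>j\<in>F. if j = i then cnj (c j) * c i else 0)"
    unfolding cinner_sum_left cinner_sum_right
    by (intro sum.cong refl) (use F on in \<open>auto simp: cinner_scaleC_left cinner_scaleC_right subset_iff\<close>)
  also have "\<dots> = (\<Sum>i\<in>F. cnj (c i) * c i)"
    using F(1) by (simp add: sum.delta)
  also have "\<dots> = complex_of_real (\<Sum>i\<in>F. (cmod (c i))\<^sup>2)"
    by (simp add: cnj_mult_self)
  finally show ?thesis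
    unfolding cinner_self of_real_eq_iff .
qed

text \<open>For the projection \<open>y\<close> of \<open>x\<close> onto the span,
  \<open>cinner x y\<close> is the squared norm of \<open>y\<close>; Cauchy-Schwarz then forces
  \<open>norm y \<le> norm x\<close>.\<close>

lemma bessel_finite:
  assumes on: "\<And>i j. i \<in> I \<Longrightarrow> j \<in> I \<Longrightarrow> cinner (e i) (e j) = (if i = j then 1 else 0)"
    and F: "finite F" "F \<subseteq> I"
  shows "(\<Sum>i\<in>F. (cmod (cinner (e i) x))\<^sup>2) \<le> (norm x)\<^sup>2"
proof -
  define y where "y = (\<Sum>i\<in>F. cinner (e i) x *\<^sub>C e i)"
  have y: "(norm y)\<^sup>2 = (\<Sum>i\<in>F. (cmod (cinner (e i) x))\<^sup>2)"
    unfolding y_def by (rule norm_sum_orthonormal[OF on F])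
  have "cinner x y = (\<Sum>i\<in>F. cinner (e i) x * cnj (cinner (e i) x))"
    unfolding y_def cinner_sum_right cinner_scaleC_right
    by (intro sum.cong refl) (subst (2) cinner_commute, simp)
  also have "\<dots> = complex_of_real ((norm y)\<^sup>2)"
    unfolding y by (simp add: mult_cnj_self)
  finally have "norm y * norm y \<le> norm x * norm y"
    using norm_cinner_le[of x y] by (simp add: power2_eq_square norm_mult)
  then have "norm y \<le> norm x"
    by (cases "norm y = 0") (auto simp: mult_le_cancel_right)
  then show ?thesis
    using y by (metis norm_ge_zero power_mono)
qed

text \<open>By Pythagoras, squared norms of blocks of the vector series are blocks of the scalar
  series, so the finite partial sums form a Cauchy net. Filters replace sequences because
  \<open>I\<close> may be uncountable.\<close>

lemma summable_on_orthonormal: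
  fixes e :: "'i \<Rightarrow> 'a::complex_hilbert_space"
  assumes on: "\<And>i j. i \<in> I \<Longrightarrow> j \<in> I \<Longrightarrow> cinner (e i) (e j) = (if i = j then 1 else 0)"
    and c: "(\<lambda>i. (cmod (c i))\<^sup>2) summable_on I"
  shows "(\<lambda>i. c i *\<^sub>C e i) summable_on I"
proof -
  let ?f = "\<lambda>i. c i *\<^sub>C e i" and ?g = "\<lambda>i. (cmod (c i))\<^sup>2"
  obtain s where s: "(?g has_sum s) I"
    using c by (auto simp: summable_on_def)
  have "\<exists>P. eventually P (finite_subsets_at_top I) \<and>
      (\<forall>F F'. P F \<and> P F' \<longrightarrow> dist (sum ?f F) (sum ?f F') < \<epsilon>)" if "\<epsilon> > 0" for \<epsilon>
  proof -
    \<comment> \<open>Squared because \<open>?g\<close> measures squared distances; halved to leave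
      room for the triangle inequality through \<open>F0\<close>.\<close>
    define \<delta> where "\<delta> = (\<epsilon> / 2)\<^sup>2"
    have \<delta>: "\<delta> > 0"
      using that by (simp add: \<delta>_def)
    then have "eventually (\<lambda>F. dist (sum ?g F) s < \<delta>) (finite_subsets_at_top I)"
      using s by (auto simp: has_sum_def tendsto_iff)
    then obtain F0 where F0: "finite F0" "F0 \<subseteq> I"
      "\<And>F. finite F \<Longrightarrow> F0 \<subseteq> F \<Longrightarrow> F \<subseteq> I \<Longrightarrow> dist (sum ?g F) s < \<delta>"
      unfolding eventually_finite_subsets_at_top by auto
    have close: "dist (sum ?f F) (sum ?f F0) < \<epsilon> / 2"
      if F: "finite F" "F0 \<subseteq> F" "F \<subseteq> I" for F
    proof -
      have "(dist (sum ?f F) (sum ?f F0))\<^sup>2 = (norm (sum ?f (F - F0)))\<^sup>2"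
        by (simp add: dist_norm sum_diff F)
      also have "\<dots> = sum ?g (F - F0)"
        by (rule norm_sum_orthonormal[OF on]) (use F in auto)
      also have "\<dots> = sum ?g F - sum ?g F0"
        by (simp add: sum_diff F)
      also have "\<dots> < \<delta>"
      proof -
        have "sum ?g F \<le> s"
          by (rule finite_sum_le_has_sum[OF s]) (use F in auto)
        moreover have "s - sum ?g F0 < \<delta>"
          using F0(3)[OF F0(1) order_refl F0(2)] by (simp add: dist_real_def)
        ultimately show ?thesis by linarith
      qed
      finally show ?thesis
        unfolding \<delta>_def by (rule power2_less_imp_less) (use that \<open>\<epsilon> > 0\<close> in auto)
    qed
    let ?P = "\<lambda>F. finite F \<and> F0 \<subseteq> F \<and> F \<subseteq> I"
    have "eventually ?P (finite_subsets_at_top I)"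
      unfolding eventually_finite_subsets_at_top using F0 by auto
    moreover have "dist (sum ?f F) (sum ?f F') < \<epsilon>" if "?P F" "?P F'" for F F'
      using close[of F] close[of F'] that dist_triangle_half_l[of "sum ?f F" "sum ?f F0" \<epsilon> "sum ?f F'"]
      by blast
    ultimately show ?thesis
      by (intro exI[of _ ?P] conjI allI impI) auto
  qed
  then have "cauchy_filter (filtermap (sum ?f) (finite_subsets_at_top I))"
    by (simp add: cauchy_filter_metric_filtermap)
  moreover have "complete (UNIV::'a set)"
    by (meson Cauchy_convergent UNIV_I complete_def convergent_def)
  ultimately obtain y where "(sum ?f \<longlongrightarrow> y) (finite_subsets_at_top I)"
    using complete_uniform[where S = UNIV] by (force simp: filterlim_def)
  then show ?thesis
    unfolding summable_on_def has_sum_def by blast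
qed

text \<open>The family need not be complete here, so the lemma serves both the expansion in a basis
  and the maximality argument that produces one.\<close>

lemma orthonormal_residual:
  fixes e :: "'i \<Rightarrow> 'a::complex_hilbert_space"
  assumes on: "\<And>i j. i \<in> I \<Longrightarrow> j \<in> I \<Longrightarrow> cinner (e i) (e j) = (if i = j then 1 else 0)"
  obtains y where "((\<lambda>i. cinner (e i) x *\<^sub>C e i) has_sum y) I" "\<And>i. i \<in> I \<Longrightarrow> cinner (e i) (x - y) = 0"
proof -
  have "(\<lambda>i. (cmod (cinner (e i) x))\<^sup>2) summable_on I"
    by (rule nonneg_bdd_above_summable_on)
      (auto intro!: bdd_aboveI2[where M = "(norm x)\<^sup>2"] bessel_finite[OF on])
  from summable_on_orthonormal[OF on this]
  obtain y where y: "((\<lambda>i. cinner (e i) x *\<^sub>C e i) has_sum y) I"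
    by (auto simp: summable_on_def)
  have "cinner (e i) (x - y) = 0" if i: "i \<in> I" for i
  proof -
    have "((\<lambda>j. cinner (e i) (cinner (e j) x *\<^sub>C e j)) has_sum cinner (e i) y) I"
      by (rule bounded_clinear_has_sum[OF bounded_clinear_cinner y])
    moreover have "((\<lambda>j. cinner (e i) (cinner (e j) x *\<^sub>C e j)) has_sum cinner (e i) x) I"
      by (rule has_sum_finite_neutralI[where B = "{i}"]) (auto simp: i cinner_scaleC_right on)
    ultimately have "cinner (e i) y = cinner (e i) x"
      by (rule has_sum_unique)
    then show ?thesis
      by (simp add: cinner_diff_right)
  qed
  then show thesis
    using that y by blast
qed

lemma orthonormal_basisD:
  assumes "orthonormal_basis e I"
  shows orthonormal_basis_cinner:
    "\<And>i j. i \<in> I \<Longrightarrow> j \<in> I \<Longrightarrow> cinner (e i) (e j) = (if i = j then 1 else 0)"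
    and orthonormal_basis_dense: "closure (cspan (e ` I)) = UNIV"
  using assms by (auto simp: orthonormal_basis_def)

text \<open>The residual is orthogonal to a dense span and therefore 0.\<close>

lemma orthonormal_basis_expansion:
  assumes "orthonormal_basis e I"
  shows "((\<lambda>i. cinner (e i) x *\<^sub>C e i) has_sum x) I"
proof -
  obtain y where y: "((\<lambda>i. cinner (e i) x *\<^sub>C e i) has_sum y) I" "\<And>i. i \<in> I \<Longrightarrow> cinner (e i) (x - y) = 0"
    using orthonormal_residual[of I e x, OF orthonormal_basis_cinner[OF assms]] by blast
  have "x = y"
    by (rule cinner_ext_dense[OF orthonormal_basis_dense[OF assms]]) (use y(2) in \<open>auto simp: cinner_diff_right\<close>)
  then show ?thesis
    using y(1) by simp
qed

lemma parseval:
  assumes "orthonormal_basis e I"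
  shows "((\<lambda>i. cinner x (e i) * cinner (e i) y) has_sum cinner x y) I"
  using bounded_clinear_has_sum[OF bounded_clinear_cinner[of x] orthonormal_basis_expansion[OF assms, of y]]
  by (simp add: cinner_scaleC_right mult.commute)

lemma parseval_norm:
  assumes "orthonormal_basis e I"
  shows "((\<lambda>i. (cmod (cinner (e i) x))\<^sup>2) has_sum (norm x)\<^sup>2) I"
proof -
  have "cinner x (e i) * cinner (e i) x = complex_of_real ((cmod (cinner (e i) x))\<^sup>2)" for i
    by (subst cinner_commute) (simp add: cnj_mult_self)
  then show ?thesis
    using parseval[OF assms, of x x] by (simp only: cinner_self has_sum_of_real_iff)
qed

text \<open>Zorn's lemma gives a maximal orthonormal set; a nonzero residual, once normalised, would
  enlarge it. This justifies the choice in \<open>some_basis\<close>.\<close>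

lemma orthonormal_basis_exists:
  "\<exists>B::'a::complex_hilbert_space set. orthonormal_basis (\<lambda>b. b) B"
proof -
  let ?ON = "\<lambda>B::'a set. \<forall>x\<in>B. \<forall>y\<in>B. cinner x y = (if x = y then 1 else 0)"
  have "\<exists>M\<in>{B. ?ON B}. \<forall>X\<in>{B. ?ON B}. M \<subseteq> X \<longrightarrow> X = M"
  proof (rule subset_Zorn_nonempty)
    show "{B. ?ON B} \<noteq> {}"
      by (auto intro: exI[of _ "{}"])
    fix \<C> assume "\<C> \<noteq> {}" and ch: "subset.chain {B. ?ON B} \<C>"
    \<comment> \<open>Any two elements of the union of a chain lie in a common member of it.\<close>
    have "cinner x y = (if x = y then 1 else 0)" if "x \<in> X" "X \<in> \<C>" "y \<in> Y" "Y \<in> \<C>" for x y X Y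
    proof -
      have "X \<subseteq> Y \<or> Y \<subseteq> X"
        using ch that by (auto simp: subset_chain_def)
      then have "{x, y} \<subseteq> X \<or> {x, y} \<subseteq> Y"
        using that by auto
      moreover have "?ON X" "?ON Y"
        using ch that by (auto simp: subset_chain_def)
      ultimately show ?thesis by auto
    qed
    then show "\<Union>\<C> \<in> {B. ?ON B}" by blast
  qed
  then obtain B where B: "?ON B" and max: "\<And>X. ?ON X \<Longrightarrow> B \<subseteq> X \<Longrightarrow> X = B"
    by auto
  have "x \<in> closure (cspan B)" for x
  proof -
    obtain y where y: "((\<lambda>b. cinner b x *\<^sub>C b) has_sum y) B" "\<And>b. b \<in> B \<Longrightarrow> cinner b (x - y) = 0"
      using orthonormal_residual[of B "\<lambda>b. b" x] B by blast
    have "x = y"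
    proof (rule ccontr)
      assume "x \<noteq> y"
      define z where "z = (1 / norm (x - y)) *\<^sub>R (x - y)"
      have z: "cinner z z = 1"
        using \<open>x \<noteq> y\<close> by (simp add: z_def cinner_self)
      have bz: "cinner b z = 0" if "b \<in> B" for b
        by (simp add: z_def cinner_scaleR_right y(2)[OF that])
      have zb: "cinner z b = 0" if "b \<in> B" for b
        using bz[OF that] by (subst cinner_commute) simp
      have "z \<notin> B"
        using bz z by fastforce
      moreover have "?ON (insert z B)"
        using B bz zb z \<open>z \<notin> B\<close> by auto
      ultimately show False
        using max[of "insert z B"] by auto
    qed
    have "sum (\<lambda>b. cinner b x *\<^sub>C b) F \<in> cspan B" if "F \<subseteq> B" for F
      using that by (intro complex_vector.span_sum complex_vector.span_scale complex_vector.span_base) auto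
    then have "eventually (\<lambda>F. sum (\<lambda>b. cinner b x *\<^sub>C b) F \<in> closure (cspan B)) (finite_subsets_at_top B)"
      by (intro eventually_finite_subsets_at_top_weakI) (use closure_subset in blast)
    then show ?thesis
      using y(1) unfolding \<open>x = y\<close> has_sum_def
      by (intro Lim_in_closed_set[OF closed_closure]) auto
  qed
  then have "closure (cspan B) = UNIV"
    by blast
  then have "orthonormal_basis (\<lambda>b. b) B"
    unfolding orthonormal_basis_def image_ident using B by (rule conjI[rotated])
  then show ?thesis ..
qed

lemma some_basis: "orthonormal_basis (\<lambda>b. b) some_basis"
  unfolding some_basis_def by (rule someI_ex[OF orthonormal_basis_exists])

section \<open>Adjoints\<close>

text \<open>The representing vector has the coefficients \<open>cnj (f b)\<close>. They are square
  summable because evaluating \<open>f\<close> on a finite truncation \<open>u\<close> gives the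
  squared norm of \<open>u\<close>, which is at most \<open>K * norm u\<close>.\<close>

lemma riesz:
  fixes f :: "'a::complex_hilbert_space \<Rightarrow> complex"
  assumes f: "bounded_clinear f"
  shows "\<exists>v. \<forall>x. f x = cinner v x"
proof -
  let ?B = "some_basis :: 'a set"
  note on = orthonormal_basis_cinner[OF some_basis]
  obtain K where K: "K \<ge> 0" "\<And>x. norm (f x) \<le> norm x * K"
    using bounded_linear.nonneg_bounded[OF bounded_clinear_bounded_linear[OF f]] by blast
  have "(\<Sum>b\<in>F. (cmod (cnj (f b)))\<^sup>2) \<le> K\<^sup>2" if F: "F \<subseteq> ?B" "finite F" for F
  proof -
    define u where "u = (\<Sum>b\<in>F. cnj (f b) *\<^sub>C b)"
    have u: "(norm u)\<^sup>2 = (\<Sum>b\<in>F. (cmod (cnj (f b)))\<^sup>2)"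
      unfolding u_def using F by (intro norm_sum_orthonormal[OF on]) auto
    have "f u = (\<Sum>b\<in>F. cnj (f b) * f b)"
      unfolding u_def
      by (simp add: linear_sum[OF bounded_linear.linear[OF bounded_clinear_bounded_linear[OF f]]]
          bounded_clinear_scaleC[OF f] scaleC_complex_def)
    also have "\<dots> = complex_of_real ((norm u)\<^sup>2)"
      unfolding u by (simp add: cnj_mult_self)
    finally have "norm u * norm u \<le> K * norm u"
      using K(2)[of u] by (simp add: power2_eq_square norm_mult mult.commute)
    then have "norm u \<le> K"
      using K(1) by (cases "norm u = 0") (auto simp: mult_le_cancel_right)
    then show ?thesis
      unfolding u[symmetric] by (simp add: power_mono)
  qed
  then have "(\<lambda>b. (cmod (cnj (f b)))\<^sup>2) summable_on ?B"
    by (intro nonneg_bdd_above_summable_on) (auto intro!: bdd_aboveI2[where M = "K\<^sup>2"])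
  from summable_on_orthonormal[OF on this]
  obtain v where v: "((\<lambda>b. cnj (f b) *\<^sub>C b) has_sum v) ?B"
    by (auto simp: summable_on_def)
  have "f = cinner v"
  proof (rule bounded_clinear_eq_on_dense[OF f bounded_clinear_cinner orthonormal_basis_dense[OF some_basis]])
    fix b assume "b \<in> (\<lambda>b. b) ` ?B"
    then have b: "b \<in> ?B" by simp
    have "((\<lambda>c. cinner b (cnj (f c) *\<^sub>C c)) has_sum cinner b v) ?B"
      by (rule bounded_clinear_has_sum[OF bounded_clinear_cinner v])
    moreover have "((\<lambda>c. cinner b (cnj (f c) *\<^sub>C c)) has_sum cnj (f b)) ?B"
      by (rule has_sum_finite_neutralI[where B = "{b}"]) (auto simp: b cinner_scaleC_right on)
    ultimately have "cinner b v = cnj (f b)"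
      by (rule has_sum_unique)
    then show "f b = cinner v b"
      by (subst cinner_commute) simp
  qed
  then show ?thesis
    by (intro exI[of _ v]) simp
qed

text \<open>Riesz representation of \<open>y \<mapsto> cinner x (A y)\<close> supplies the witness
  for the definite description in \<open>cadjoint\<close>.\<close>

lemma cinner_cadjoint:
  assumes A: "bounded_clinear A"
  shows "cinner (cadjoint A x) y = cinner x (A y)"
proof -
  have "\<exists>v. \<forall>y. cinner x (A y) = cinner v y" for x
    by (rule riesz[OF bounded_clinear_cinner_right[OF A]])
  then obtain B where B: "\<And>x y. cinner x (A y) = cinner (B x) y"
    by metis
  have "\<forall>x y. cinner (cadjoint A x) y = cinner x (A y)"
    unfolding cadjoint_def
  proof (rule theI[where a = B])
    show "C = B" if "\<forall>x y. cinner (C x) y = cinner x (A y)" for C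
    proof
      show "C x = B x" for x
        by (rule cinner_ext, subst (1 2) cinner_commute) (simp add: that B)
    qed
  qed (simp add: B)
  then show ?thesis by simp
qed

lemma cinner_cadjoint_right:
  "bounded_clinear A \<Longrightarrow> cinner y (cadjoint A x) = cinner (A y) x"
  by (subst (1 2) cinner_commute) (simp add: cinner_cadjoint)

text \<open>For the bound, the squared norm of \<open>cadjoint A x\<close> is
  \<open>cinner x (A (cadjoint A x))\<close>, and one factor cancels.\<close>

lemma bounded_clinear_cadjoint:
  assumes A: "bounded_clinear A"
  shows "bounded_clinear (cadjoint A)"
proof -
  obtain K where K: "K \<ge> 0" "\<And>x. norm (A x) \<le> norm x * K"
    using bounded_linear.nonneg_bounded[OF bounded_clinear_bounded_linear[OF A]] by blast
  show ?thesis
  proof (rule bounded_clinearI[where K = K])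
    show "cadjoint A (x + y) = cadjoint A x + cadjoint A y" for x y
      by (rule cinner_ext) (simp add: cinner_cadjoint_right[OF A] cinner_add_right)
    show "cadjoint A (c *\<^sub>C x) = c *\<^sub>C cadjoint A x" for c x
      by (rule cinner_ext) (simp add: cinner_cadjoint_right[OF A] cinner_scaleC_right)
    show "norm (cadjoint A x) \<le> K * norm x" for x
    proof -
      let ?y = "cadjoint A x"
      have "norm ?y * norm ?y = cmod (cinner x (A ?y))"
        using cinner_cadjoint[OF A, of x ?y, symmetric]
        by (simp add: cinner_self power2_eq_square norm_mult)
      also have "\<dots> \<le> norm x * (norm ?y * K)"
        using norm_cinner_le[of x "A ?y"] mult_left_mono[OF K(2)[of ?y], of "norm x"] by simp
      finally have "norm ?y * norm ?y \<le> (K * norm x) * norm ?y"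
        by (simp add: mult_ac)
      then show ?thesis
        using K(1) by (cases "norm ?y = 0") (auto simp: mult_le_cancel_right)
    qed
  qed
qed

section \<open>Mixtures of vector states\<close>

text \<open>The operator sum of |v_i><v_i|. In this form conjugation, tensor products and partial
  traces become operations on families of vectors. A divergent series would give the default value
  0, hence the assumption \<open>square_summable\<close> below.\<close>

definition mixture :: "('i \<Rightarrow> 'a::complex_hilbert_space) \<Rightarrow> 'i set \<Rightarrow> 'a \<Rightarrow> 'a" where
  "mixture v I x = (\<Sum>\<^sub>\<infinity>i\<in>I. cinner (v i) x *\<^sub>C v i)"

abbreviation square_summable :: "('i \<Rightarrow> 'a::complex_hilbert_space) \<Rightarrow> 'i set \<Rightarrow> bool" where
  "square_summable v I \<equiv> (\<lambda>i. (norm (v i))\<^sup>2) summable_on I"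

lemma norm_mixture_term: "norm (cinner u x *\<^sub>C u) \<le> norm x * (norm u)\<^sup>2"
proof -
  have "norm (cinner u x *\<^sub>C u) \<le> (norm u * norm x) * norm u"
    unfolding norm_scaleC by (rule mult_right_mono[OF norm_cinner_le norm_ge_zero])
  then show ?thesis
    by (simp add: power2_eq_square mult_ac)
qed

lemma mixture_abs_summable:
  assumes "square_summable v I"
  shows "(\<lambda>i. norm (cinner (v i) x *\<^sub>C v i)) summable_on I"
  by (rule Infinite_Sum.abs_summable_on_comparison_test'[OF summable_on_cmult_right[OF assms, of "norm x"]])
    (simp add: norm_mixture_term)

lemma mixture_has_sum:
  assumes "square_summable v I"
  shows "((\<lambda>i. cinner (v i) x *\<^sub>C v i) has_sum mixture v I x) I"
  unfolding mixture_def using Infinite_Sum.abs_summable_summable[OF mixture_abs_summable[OF assms]] by simp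

lemma bounded_clinear_mixture:
  assumes v: "square_summable v I"
  shows "bounded_clinear (mixture v I)"
proof (rule bounded_clinearI[where K = "\<Sum>\<^sub>\<infinity>i\<in>I. (norm (v i))\<^sup>2"])
  show "mixture v I (x + y) = mixture v I x + mixture v I y" for x y
    by (rule has_sum_unique[OF mixture_has_sum[OF v]])
      (use has_sum_add[OF mixture_has_sum[OF v, of x] mixture_has_sum[OF v, of y]]
        in \<open>simp add: cinner_add_right scaleC_add_left\<close>)
  show "mixture v I (c *\<^sub>C x) = c *\<^sub>C mixture v I x" for c x
    by (rule has_sum_unique[OF mixture_has_sum[OF v]])
      (use bounded_clinear_has_sum[OF bounded_clinear_const_scaleC[OF bounded_clinear_id, of c]
          mixture_has_sum[OF v, of x]]
        in \<open>simp add: cinner_scaleC_right scaleC_scaleC\<close>)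
  show "norm (mixture v I x) \<le> (\<Sum>\<^sub>\<infinity>i\<in>I. (norm (v i))\<^sup>2) * norm x" for x
  proof -
    have "norm (mixture v I x) \<le> (\<Sum>\<^sub>\<infinity>i\<in>I. norm (cinner (v i) x *\<^sub>C v i))"
      unfolding mixture_def by (rule norm_infsum_bound[OF mixture_abs_summable[OF v]])
    also have "\<dots> \<le> (\<Sum>\<^sub>\<infinity>i\<in>I. norm x * (norm (v i))\<^sup>2)"
      by (intro infsum_mono mixture_abs_summable[OF v] summable_on_cmult_right v norm_mixture_term)
    finally show ?thesis
      by (simp add: infsum_cmult_right[OF v] mult.commute)
  qed
qed

lemma square_summable_image:
  assumes W: "bounded_clinear W" and v: "square_summable v I"
  shows "square_summable (\<lambda>i. W (v i)) I"
proof -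
  obtain K where K: "\<And>x. norm (W x) \<le> norm x * K"
    using bounded_linear.bounded[OF bounded_clinear_bounded_linear[OF W]] by blast
  show ?thesis
  proof (rule summable_on_comparison_test[OF summable_on_cmult_left[OF v, of "K\<^sup>2"]])
    show "(norm (W (v i)))\<^sup>2 \<le> (norm (v i))\<^sup>2 * K\<^sup>2" for i
      using power_mono[OF K[of "v i"] norm_ge_zero, of 2] by (simp add: power_mult_distrib)
  qed simp
qed

text \<open>W |v><v| W* is |Wv><Wv|, and the bounded \<open>W\<close> may be moved inside the
  series.\<close>

lemma mixture_conjugate:
  assumes W: "bounded_clinear W" and v: "square_summable v I"
    and adj: "\<And>x y. cinner x (A y) = cinner (W x) y"
  shows "W \<circ> mixture v I \<circ> A = mixture (\<lambda>i. W (v i)) I"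
proof
  fix x
  have "((\<lambda>i. W (cinner (v i) (A x) *\<^sub>C v i)) has_sum W (mixture v I (A x))) I"
    by (rule bounded_clinear_has_sum[OF W mixture_has_sum[OF v]])
  then have "((\<lambda>i. cinner (W (v i)) x *\<^sub>C W (v i)) has_sum W (mixture v I (A x))) I"
    by (simp add: bounded_clinear_scaleC[OF W] adj)
  then show "(W \<circ> mixture v I \<circ> A) x = mixture (\<lambda>i. W (v i)) I x"
    using has_sum_unique[OF mixture_has_sum[OF square_summable_image[OF W v]]] by simp
qed

lemma square_summable_matrix_elements:
  assumes "square_summable v I"
  shows "(\<lambda>(i, b). (cmod (cinner b (v i)))\<^sup>2) summable_on I \<times> some_basis"
  by (rule summable_on_SigmaI[OF _ assms]) (simp_all add: parseval_norm[OF some_basis])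

text \<open>The double family over indices \<open>i\<close> and basis vectors \<open>b\<close> is
  absolutely summable. Summing over \<open>b\<close> first is Parseval; summing over
  \<open>i\<close> first gives the trace.\<close>

lemma trace_op_mixture:
  assumes E: "bounded_clinear E" and v: "square_summable v I"
  shows "((\<lambda>i. cinner (v i) (E (v i))) has_sum trace_op (E \<circ> mixture v I)) I"
proof -
  define f where "f = (\<lambda>(i, b). cinner (v i) b * cinner b (E (v i)))"
  have "(\<lambda>p. norm (f p)) summable_on I \<times> some_basis"
  proof (rule Infinite_Sum.abs_summable_on_comparison_test'[OF summable_on_add[OF
          square_summable_matrix_elements[OF v]
          square_summable_matrix_elements[OF square_summable_image[OF E v]]]])
    fix p assume "p \<in> I \<times> (some_basis :: 'a set)"
    obtain i b where p: "p = (i, b)" by fastforce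
    have "norm (f p) = cmod (cinner b (v i)) * cmod (cinner b (E (v i)))"
      by (simp add: p f_def norm_mult) (subst cinner_commute, simp)
    also have "\<dots> \<le> (cmod (cinner b (v i)))\<^sup>2 + (cmod (cinner b (E (v i))))\<^sup>2"
    proof -
      have "0 \<le> (x - y)\<^sup>2 + x\<^sup>2 + y\<^sup>2" for x y :: real by simp
      then have "2 * (x * y) \<le> 2 * (x\<^sup>2 + y\<^sup>2)" for x y :: real
        by (simp add: power2_diff algebra_simps)
      from this[of "cmod (cinner b (v i))" "cmod (cinner b (E (v i)))"] show ?thesis
        by simp
    qed
    finally show "norm (f p) \<le> (case p of (i, b) \<Rightarrow> (cmod (cinner b (v i)))\<^sup>2)
        + (case p of (i, b) \<Rightarrow> (cmod (cinner b (E (v i))))\<^sup>2)"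
      by (simp add: p)
  qed
  then obtain S where S: "(f has_sum S) (I \<times> some_basis)"
    using Infinite_Sum.abs_summable_summable summable_on_def by blast
  have "((\<lambda>i. cinner (v i) (E (v i))) has_sum S) I"
    by (rule has_sum_SigmaD[OF S]) (simp add: f_def parseval[OF some_basis])
  moreover have "((\<lambda>b. cinner b (E (mixture v I b))) has_sum S) some_basis"
  proof (rule has_sum_SigmaD)
    show "((\<lambda>(b, i). f (i, b)) has_sum S) (some_basis \<times> I)"
      using S by (subst (asm) has_sum_swap)
    fix b :: 'a
    have "((\<lambda>i. cinner b (E (cinner (v i) b *\<^sub>C v i))) has_sum cinner b (E (mixture v I b))) I"
      by (rule bounded_clinear_has_sum[OF bounded_clinear_cinner_right[OF E] mixture_has_sum[OF v]])
    then show "((\<lambda>i. case (b, i) of (b, i) \<Rightarrow> f (i, b)) has_sum cinner b (E (mixture v I b))) I"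
      by (simp add: f_def bounded_clinear_scaleC[OF E] cinner_scaleC_right)
  qed
  then have "trace_op (E \<circ> mixture v I) = S"
    by (simp add: trace_op_def infsumI)
  ultimately show ?thesis by simp
qed

section \<open>Positive operators\<close>

lemma positive_op_bounded_clinear: "positive_op A \<Longrightarrow> bounded_clinear A"
  by (simp add: positive_op_def)

lemma positive_op_cinner:
  assumes "positive_op A"
  shows "cinner x (A x) = complex_of_real (Re (cinner x (A x)))" and "0 \<le> Re (cinner x (A x))"
  using assms by (auto simp: positive_op_def less_eq_complex_def complex_eq_iff)

text \<open>Polarisation: the quadratic form is real at \<open>x + y\<close> and at
  \<open>x + \<i> *\<^sub>C y\<close>, which settles the imaginary and the real part.\<close>

lemma positive_op_hermitian:
  assumes A: "positive_op A"
  shows "cinner y (A x) = cnj (cinner x (A y))"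
proof -
  note bc = positive_op_bounded_clinear[OF A]
  have real: "Im (cinner z (A z)) = 0" for z
    by (subst positive_op_cinner(1)[OF A]) simp
  have "Im (cinner x (A y)) + Im (cinner y (A x)) = 0"
    using real[of "x + y"] real[of x] real[of y]
    by (simp add: bounded_clinear_add[OF bc] cinner_add_left cinner_add_right)
  moreover have "Re (cinner x (A y)) - Re (cinner y (A x)) = 0"
    using real[of "x + \<i> *\<^sub>C y"] real[of x] real[of y]
    by (simp add: bounded_clinear_add[OF bc] bounded_clinear_scaleC[OF bc] cinner_add_left
        cinner_add_right cinner_scaleC_left cinner_scaleC_right)
  ultimately show ?thesis
    by (simp add: complex_eq_iff)
qed

lemma positive_op_cauchy_schwarz:
  assumes A: "positive_op A"
  shows "(cmod (cinner b (A x)))\<^sup>2 \<le> Re (cinner b (A b)) * Re (cinner x (A x))"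
proof -
  note bc = positive_op_bounded_clinear[OF A]
  define w where "w = cinner b (A x)"
  define a where "a = Re (cinner b (A b))"
  define p where "p = Re (cinner x (A x))"
  have a: "cinner b (A b) = complex_of_real a" "a \<ge> 0" and p: "cinner x (A x) = complex_of_real p" "p \<ge> 0"
    unfolding a_def p_def using positive_op_cinner[OF A] by auto
  have w': "cinner x (A b) = cnj w"
    unfolding w_def by (rule positive_op_hermitian[OF A])
  have quad: "0 \<le> p - 2 * t * (cmod w)\<^sup>2 + t\<^sup>2 * (cmod w)\<^sup>2 * a" for t
  proof -
    \<comment> \<open>Giving \<open>c\<close> the phase of \<open>w\<close> makes the cross terms
      real, so only a real quadratic in \<open>t\<close> remains.\<close>
    define c where "c = complex_of_real t * w"
    have "cinner (x - c *\<^sub>C b) (A (x - c *\<^sub>C b)) = of_real p - c * cnj w - cnj c * w + (cnj c * c) * of_real a"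
      by (simp add: bounded_clinear_diff[OF bc] bounded_clinear_scaleC[OF bc] cinner_diff_left
          cinner_diff_right cinner_scaleC_left cinner_scaleC_right a p w' w_def[symmetric] algebra_simps)
    also have "\<dots> = of_real p - of_real t * (w * cnj w) - of_real t * (cnj w * w)
        + of_real (t\<^sup>2) * (cnj w * w) * of_real a"
      by (simp add: c_def power2_eq_square mult_ac)
    also have "\<dots> = complex_of_real (p - 2 * t * (cmod w)\<^sup>2 + t\<^sup>2 * (cmod w)\<^sup>2 * a)"
      unfolding cnj_mult_self mult_cnj_self by simp
    finally show ?thesis
      using positive_op_cinner(2)[OF A, of "x - c *\<^sub>C b"] by simp
  qed
  have "(cmod w)\<^sup>2 \<le> a * p"
  proof (cases "a = 0")
    case False
    then have "0 \<le> p - (cmod w)\<^sup>2 / a"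
      \<comment> \<open>The value of \<open>t\<close> that minimises the quadratic when
        \<open>w\<close> is nonzero.\<close>
      using quad[of "1 / a"] by (simp add: power2_eq_square)
    then show ?thesis
      using a(2) False by (simp add: field_simps)
  next
    case True
    have "cmod w = 0"
    proof (rule ccontr)
      assume "cmod w \<noteq> 0"
      then show False
        \<comment> \<open>With \<open>a = 0\<close> the quadratic is affine in \<open>t\<close>;
          this \<open>t\<close> gives it the value -1.\<close>
        using quad[of "(p + 1) / (2 * (cmod w)\<^sup>2)"] True p(2) by simp
    qed
    then show ?thesis
      using True by simp
  qed
  then show ?thesis
    by (simp add: w_def a_def p_def)
qed

text \<open>Cauchy-Schwarz for the form of \<open>A\<close>, with \<open>A x\<close> as the other
  vector, bounds the norm of \<open>A x\<close> by 0.\<close>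

lemma positive_op_eq_0:
  assumes "positive_op A" "Re (cinner x (A x)) = 0"
  shows "A x = 0"
  using positive_op_cauchy_schwarz[OF assms(1), of "A x" x] assms(2) by simp

text \<open>If \<open>\<langle>b|A|b\<rangle> = 0\<close> then \<open>A b = 0\<close> for positive \<open>A\<close>, so division by zero is harmless here.\<close>

definition pivot :: "('a::complex_hilbert_space \<Rightarrow> 'a) \<Rightarrow> 'a \<Rightarrow> 'a" where
  "pivot A b = (1 / sqrt (Re (cinner b (A b)))) *\<^sub>R A b"

text \<open>One step of Cholesky elimination: the Schur complement A - A|b><b|A / <b|A|b>, or
  \<open>A\<close> itself when the denominator is 0.\<close>

definition deflate :: "('a::complex_hilbert_space \<Rightarrow> 'a) \<Rightarrow> 'a \<Rightarrow> 'a \<Rightarrow> 'a" where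
  "deflate A b = (\<lambda>x. A x - ketbra (pivot A b) x)"

lemma cinner_ketbra: "cinner x (ketbra u x) = complex_of_real ((cmod (cinner x u))\<^sup>2)"
proof -
  have "cinner x (ketbra u x) = cnj (cinner x u) * cinner x u"
    unfolding ketbra_def cinner_scaleC_right by (subst (1) cinner_commute) simp
  then show ?thesis
    by (simp only: cnj_mult_self)
qed

lemma bounded_clinear_ketbra: "bounded_clinear (ketbra u)"
  unfolding ketbra_def
  by (rule bounded_clinear_compose[OF bounded_clinear_scaleC_left bounded_clinear_cinner])

lemma cinner_pivot:
  assumes A: "positive_op A"
  shows "cinner (pivot A b) x = complex_of_real (1 / sqrt (Re (cinner b (A b)))) * cinner b (A x)"
  unfolding pivot_def positive_op_hermitian[OF A, of b x]
  by (subst cinner_commute) (simp add: cinner_scaleR_right)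

text \<open>Positivity of the Schur complement is exactly the Cauchy-Schwarz inequality for the form
  of \<open>A\<close>.\<close>

lemma positive_op_deflate:
  assumes A: "positive_op A"
  shows "positive_op (deflate A b)"
  unfolding positive_op_def
proof (intro conjI allI)
  show "bounded_clinear (deflate A b)"
    unfolding deflate_def
    by (intro bounded_clinear_sub positive_op_bounded_clinear[OF A] bounded_clinear_ketbra)
  fix x
  define a where "a = Re (cinner b (A b))"
  define p where "p = Re (cinner x (A x))"
  have a: "a \<ge> 0" and p: "cinner x (A x) = complex_of_real p" "p \<ge> 0"
    unfolding a_def p_def using positive_op_cinner[OF A] by auto
  have "(cmod (cinner x (pivot A b)))\<^sup>2 = (cmod (cinner b (A x)))\<^sup>2 / a"
    using a by (subst cinner_commute)
      (simp add: cinner_pivot[OF A] norm_mult norm_divide power_divide a_def[symmetric])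
  also have "\<dots> \<le> p"
    using positive_op_cauchy_schwarz[OF A, of b x] a p(2)
    by (cases "a = 0") (simp_all add: a_def[symmetric] p_def[symmetric] field_simps)
  finally show "0 \<le> cinner x (deflate A b x)"
    unfolding deflate_def cinner_diff_right cinner_ketbra p(1) of_real_diff[symmetric]
    by (simp add: less_eq_complex_def)
qed

text \<open>Later eliminations preserve earlier ones: \<open>cinner (pivot A b) c\<close> is a
  multiple of \<open>cinner b (A c)\<close>, which is 0.\<close>

lemma deflate_kernel:
  assumes A: "positive_op A" and "A c = 0"
  shows "deflate A b c = 0"
  by (simp add: deflate_def ketbra_def cinner_pivot[OF A] assms(2))

lemma deflate_pivot:
  assumes A: "positive_op A"
  shows "deflate A b b = 0"
proof (cases "Re (cinner b (A b)) = 0")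
  case True
  show ?thesis
    by (rule deflate_kernel[OF A positive_op_eq_0[OF A True]])
next
  case False
  define a where "a = Re (cinner b (A b))"
  have "a > 0"
    using False positive_op_cinner(2)[OF A, of b] by (simp add: a_def)
  have "cinner b (A b) = complex_of_real a"
    unfolding a_def by (rule positive_op_cinner(1)[OF A])
  then have "ketbra (pivot A b) b = complex_of_real (1 / sqrt a * a * (1 / sqrt a)) *\<^sub>C A b"
    unfolding ketbra_def cinner_pivot[OF A]
    by (simp add: pivot_def scaleR_eq_scaleC scaleC_scaleC of_real_mult[symmetric] del: of_real_mult)
  also have "1 / sqrt a * a * (1 / sqrt a) = 1"
    using \<open>a > 0\<close> by (simp add: field_simps)
  finally show ?thesis
    by (simp add: deflate_def)
qed

primrec residual ::
  "('a::complex_hilbert_space \<Rightarrow> 'a) \<Rightarrow> (nat \<Rightarrow> 'a) \<Rightarrow> nat \<Rightarrow> 'a \<Rightarrow> 'a" where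
  "residual A \<beta> 0 = A"
| "residual A \<beta> (Suc n) = deflate (residual A \<beta> n) (\<beta> n)"

lemma positive_op_residual: "positive_op A \<Longrightarrow> positive_op (residual A \<beta> n)"
  by (induction n) (auto intro: positive_op_deflate)

lemma residual_decomposition:
  "A x = residual A \<beta> n x + (\<Sum>j<n. ketbra (pivot (residual A \<beta> j) (\<beta> j)) x)"
  by (induction n) (auto simp: deflate_def)

lemma residual_kernel:
  assumes A: "positive_op A" and "m \<le> n" "residual A \<beta> m x = 0"
  shows "residual A \<beta> n x = 0"
  using assms(2,3)
  by (induction n rule: dec_induct) (auto intro: deflate_kernel positive_op_residual[OF A])

text \<open>The vector \<open>\<beta> k\<close> is eliminated in passing to stage
  \<open>Suc k\<close> and stays in the kernel from then on.\<close>

lemma residual_basis: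
  assumes A: "positive_op A" and "k < n"
  shows "residual A \<beta> n (\<beta> k) = 0"
  by (rule residual_kernel[OF A, of "Suc k"])
    (use \<open>k < n\<close> in \<open>auto intro: deflate_pivot positive_op_residual[OF A]\<close>)

text \<open>A Cholesky factorisation along the basis vectors on which \<open>\<rho>\<close> does not vanish; the
  unit trace makes these vectors countable and the factors square summable.\<close>

lemma density_operator_mixture:
  fixes \<rho> :: "'a::complex_hilbert_space \<Rightarrow> 'a"
  assumes "density_operator \<rho>"
  obtains r :: "nat \<Rightarrow> 'a" where "square_summable r UNIV" "\<rho> = mixture r UNIV"
proof -
  let ?B = "some_basis :: 'a set"
  have \<rho>: "positive_op \<rho>" and tr: "(\<Sum>\<^sub>\<infinity>b\<in>?B. cinner b (\<rho> b)) = 1"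
    using assms by (auto simp: density_operator_def trace_op_def)
  define q where "q b = Re (cinner b (\<rho> b))" for b
  \<comment> \<open>A sum that does not exist would have the default value 0, not 1.\<close>
  have "(\<lambda>b. cinner b (\<rho> b)) summable_on ?B"
    using tr infsum_not_exists by fastforce
  then have "((\<lambda>b. cinner b (\<rho> b)) has_sum 1) ?B"
    using tr has_sum_infsum by fastforce
  from has_sum_Re[OF this] have q: "(q has_sum 1) ?B"
    by (simp add: q_def[abs_def])
  \<comment> \<open>A summable real family has countable support, so these vectors can be
    enumerated. Repetitions do no harm: only surjectivity of \<open>\<beta>\<close> enters
    below.\<close>
  define \<beta> where "\<beta> = from_nat_into {b\<in>?B. q b \<noteq> 0}"
  have \<beta>: "\<exists>k. \<beta> k = b" if "b \<in> ?B" "q b \<noteq> 0" for b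
    unfolding \<beta>_def
    by (rule from_nat_into_surj[OF summable_countable_real[OF has_sum_imp_summable[OF q]]]) (use that in simp)
  define R where "R = residual \<rho> \<beta>"
  define r where "r j = pivot (R j) (\<beta> j)" for j
  have dec: "\<rho> x = R n x + (\<Sum>j<n. ketbra (r j) x)" for n x
    unfolding R_def r_def by (rule residual_decomposition)
  have vanish: "\<exists>N. \<forall>n\<ge>N. R n b = 0" if b: "b \<in> ?B" for b
  proof (cases "q b = 0")
    case True
    then have "residual \<rho> \<beta> 0 b = 0"
      using positive_op_eq_0[OF \<rho>] by (simp add: q_def)
    then show ?thesis
      unfolding R_def using residual_kernel[OF \<rho> le0] by blast
  next
    case False
    then obtain k where "\<beta> k = b"
      using \<beta>[OF b] by blast
    then show ?thesis
      unfolding R_def using residual_basis[OF \<rho>, of k _ \<beta>] by (intro exI[of _ "Suc k"]) auto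
  qed
  \<comment> \<open>On the diagonal the residual is nonnegative, so the first \<open>n\<close>
    factors contribute at most \<open>q b\<close> at each \<open>b\<close>; summing over the basis
    with Parseval bounds their squared norms by the trace.\<close>
  have "(\<Sum>j<n. (norm (r j))\<^sup>2) \<le> 1" for n
  proof (rule has_sum_mono[OF _ q])
    show "((\<lambda>b. \<Sum>j<n. (cmod (cinner b (r j)))\<^sup>2) has_sum (\<Sum>j<n. (norm (r j))\<^sup>2)) ?B"
      by (induction n) (auto intro!: has_sum_add parseval_norm[OF some_basis])
    fix b
    have "cinner b (\<rho> b) = cinner b (R n b) + complex_of_real (\<Sum>j<n. (cmod (cinner b (r j)))\<^sup>2)"
      by (subst dec[of _ n]) (simp add: cinner_add_right cinner_sum_right cinner_ketbra)
    then have "q b = Re (cinner b (R n b)) + (\<Sum>j<n. (cmod (cinner b (r j)))\<^sup>2)"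
      unfolding q_def by (simp only: plus_complex.simps Re_complex_of_real)
    then show "(\<Sum>j<n. (cmod (cinner b (r j)))\<^sup>2) \<le> q b"
      using positive_op_cinner(2)[OF positive_op_residual[OF \<rho>, of \<beta> n], of b] by (simp add: R_def)
  qed
  then have r: "square_summable r UNIV"
    by (subst summable_on_UNIV_nonneg_real_iff) (auto intro!: summableI_nonneg_bounded)
  have "\<rho> = mixture r UNIV"
  proof (rule bounded_clinear_eq_on_dense[OF positive_op_bounded_clinear[OF \<rho>]
        bounded_clinear_mixture[OF r] orthonormal_basis_dense[OF some_basis]])
    fix b assume "b \<in> (\<lambda>b. b) ` ?B"
    then obtain N where N: "\<And>n. n \<ge> N \<Longrightarrow> R n b = 0"
      using vanish by auto
    have "(\<lambda>n. \<Sum>j<n. cinner (r j) b *\<^sub>C r j) \<longlonglongrightarrow> mixture r UNIV b"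
      using has_sum_imp_sums[OF mixture_has_sum[OF r]] by (simp add: sums_def)
    \<comment> \<open>Once the residual kills \<open>b\<close>, the partial sums at \<open>b\<close>
      are constant, so no limit of residuals in norm has to be studied.\<close>
    moreover have "(\<Sum>j<n. cinner (r j) b *\<^sub>C r j) = \<rho> b" if "n \<ge> N" for n
      using dec[of b n] N[OF that] by (simp add: ketbra_def)
    then have "(\<lambda>n. \<Sum>j<n. cinner (r j) b *\<^sub>C r j) \<longlonglongrightarrow> \<rho> b"
      by (intro tendsto_eventually eventually_sequentiallyI)
    ultimately show "\<rho> b = mixture r UNIV b"
      using LIMSEQ_unique by blast
  qed
  then show thesis
    using r that by blast
qed

section \<open>Isometries from generating families\<close>

definition isometry_op :: "('a::complex_hilbert_space \<Rightarrow> 'b::complex_hilbert_space) \<Rightarrow> bool" where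
  "isometry_op A \<longleftrightarrow> bounded_clinear A \<and> (\<forall>x y. cinner (A x) (A y) = cinner x y)"

lemma isometry_opD:
  assumes "isometry_op A"
  shows isometry_op_bounded_clinear: "bounded_clinear A"
    and isometry_op_cinner: "cinner (A x) (A y) = cinner x y"
  using assms by (auto simp: isometry_op_def)

lemma norm_eq_cinner: "cinner x x = cinner y y \<Longrightarrow> norm x = norm y"
  by (simp only: cinner_self of_real_eq_iff power2_eq_iff_nonneg norm_ge_zero)

lemma unitary_isometry_op:
  assumes "unitary_op U"
  shows "isometry_op U" and "isometry_op (cadjoint U)"
proof -
  have U: "bounded_clinear U" "cadjoint U (U x) = x" "U (cadjoint U x) = x" for x
    using assms by (auto simp: unitary_op_def fun_eq_iff)
  show "isometry_op U"
    using cinner_cadjoint[OF U(1), symmetric] by (simp add: isometry_op_def U)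
  show "isometry_op (cadjoint U)"
    using cinner_cadjoint[OF U(1)] by (simp add: isometry_op_def U bounded_clinear_cadjoint)
qed

text \<open>Provides joint continuity, by which inner products pass to limits of sequences.\<close>

lemma bounded_bilinear_cinner: "bounded_bilinear cinner"
proof
  show "cinner (r *\<^sub>R x) y = r *\<^sub>R cinner x y" for r and x y :: 'a
    by (simp add: scaleR_eq_scaleC[of r x] cinner_scaleC_left scaleR_conv_of_real)
  show "cinner x (r *\<^sub>R y) = r *\<^sub>R cinner x y" for r and x y :: 'a
    by (simp add: cinner_scaleR_right scaleR_conv_of_real)
  show "\<exists>K. \<forall>x y :: 'a. norm (cinner x y) \<le> norm x * norm y * K"
    by (intro exI[of _ 1]) (simp add: norm_cinner_le)
qed (simp_all add: cinner_add_left cinner_add_right)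

text \<open>The closure of this linear relation is the graph of the isometry.\<close>

inductive paired ::
  "('i \<Rightarrow> 'a::complex_hilbert_space) \<Rightarrow> ('i \<Rightarrow> 'b::complex_hilbert_space) \<Rightarrow> 'i set \<Rightarrow> 'a \<Rightarrow> 'b \<Rightarrow> bool"
  for g h I where
  zero: "paired g h I 0 0"
| step: "paired g h I x y \<Longrightarrow> i \<in> I \<Longrightarrow> paired g h I (x + c *\<^sub>C g i) (y + c *\<^sub>C h i)"

lemma paired_add: "paired g h I x' y' \<Longrightarrow> paired g h I x y \<Longrightarrow> paired g h I (x + x') (y + y')"
proof (induction rule: paired.induct)
  case (step x' y' i c)
  then show ?case
    using paired.step[of g h I "x + x'" "y + y'" i c] by (simp add: add.assoc)
qed simp

lemma paired_scaleC: "paired g h I x y \<Longrightarrow> paired g h I (a *\<^sub>C x) (a *\<^sub>C y)"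
proof (induction rule: paired.induct)
  case (step x y i c)
  then show ?case
    using paired.step[of g h I "a *\<^sub>C x" "a *\<^sub>C y" i "a * c"]
    by (simp add: scaleC_add_right scaleC_scaleC)
qed (simp add: paired.zero)

lemma paired_base: "i \<in> I \<Longrightarrow> paired g h I (g i) (h i)"
  using paired.step[OF paired.zero, of i I g h 1] by simp

lemma paired_diff:
  assumes "paired g h I x y" "paired g h I x' y'"
  shows "paired g h I (x - x') (y - y')"
  using paired_add[OF paired_scaleC[OF assms(2), of "-1"] assms(1)]
  by (simp add: complex_vector.scale_minus_left)

text \<open>Both inner products are the same sesquilinear expression in equal Gram matrix entries;
  one induction runs over each argument.\<close>

lemma paired_cinner:
  assumes gh: "\<And>i j. i \<in> I \<Longrightarrow> j \<in> I \<Longrightarrow> cinner (h i) (h j) = cinner (g i) (g j)"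
    and "paired g h I x y" "paired g h I x' y'"
  shows "cinner y y' = cinner x x'"
  using assms(2)
proof induction
  case (step x y i c)
  have "cinner (h i) y' = cinner (g i) x'"
    using assms(3) by induction (auto simp: cinner_add_right cinner_scaleC_right gh step.hyps)
  then show ?case
    by (simp add: cinner_add_left cinner_scaleC_left step.IH)
qed simp

lemma paired_total:
  assumes "x \<in> cspan (g ` I)"
  shows "\<exists>y. paired g h I x y"
  using assms
proof (induction rule: complex_vector.span_induct_alt)
  case base
  show ?case
    by (auto intro: paired.zero)
next
  case (step c x y)
  then obtain i y' where "i \<in> I" "x = g i" "paired g h I y y'"
    by auto
  then show ?case
    using paired_add[OF \<open>paired g h I y y'\<close> paired_scaleC[OF paired_base[OF \<open>i \<in> I\<close>]]] by auto
qed

lemma tendsto_scaleC: "(f \<longlongrightarrow> x) F \<Longrightarrow> ((\<lambda>n. c *\<^sub>C f n) \<longlongrightarrow> c *\<^sub>C x) F"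
  using bounded_linear.tendsto[OF bounded_clinear_bounded_linear[OF
        bounded_clinear_const_scaleC[OF bounded_clinear_id, of c]]] by blast

text \<open>Equal Gram matrices make the assignment of \<open>h i\<close> to \<open>g i\<close>
  isometric on linear combinations, and completeness extends it to the closure. Tensor powers of
  isometries and controlled isometries are built from this.\<close>

lemma isometry_extension:
  fixes g :: "'i \<Rightarrow> 'a::complex_hilbert_space" and h :: "'i \<Rightarrow> 'b::complex_hilbert_space"
  assumes gh: "\<And>i j. i \<in> I \<Longrightarrow> j \<in> I \<Longrightarrow> cinner (h i) (h j) = cinner (g i) (g j)"
    and dense: "closure (cspan (g ` I)) = UNIV"
  obtains W where "isometry_op W" "\<And>i. i \<in> I \<Longrightarrow> W (g i) = h i"
proof -
  define G where "G x y \<longleftrightarrow> (\<exists>X Y. (\<forall>n::nat. paired g h I (X n) (Y n)) \<and> X \<longlonglongrightarrow> x \<and> Y \<longlonglongrightarrow> y)" for x y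
  have GI: "G x y" if "\<And>n. paired g h I (X n) (Y n)" "X \<longlonglongrightarrow> x" "Y \<longlonglongrightarrow> y" for X Y x y
    unfolding G_def using that by blast
  have "\<exists>y. G x y" for x
  proof -
    obtain X where X: "\<And>n. X n \<in> cspan (g ` I)" "X \<longlonglongrightarrow> x"
      using dense closure_sequential[of x "cspan (g ` I)"] by auto
    obtain Y where Y: "\<And>n. paired g h I (X n) (Y n)"
      using paired_total[OF X(1)] by metis
    \<comment> \<open>Differences of related pairs are related again, so the images inherit the
      Cauchy property from \<open>X\<close>.\<close>
    have "norm (Y m - Y n) = norm (X m - X n)" for m n
      by (rule norm_eq_cinner, rule paired_cinner[OF gh]) (auto intro: paired_diff Y)
    then have "Cauchy Y"
      using LIMSEQ_imp_Cauchy[OF X(2)] by (simp add: Cauchy_def dist_norm)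
    then obtain y where "Y \<longlonglongrightarrow> y"
      using Cauchy_convergent convergent_def by blast
    then show ?thesis
      using GI[OF Y X(2)] by blast
  qed
  then obtain W where W: "\<And>x. G x (W x)"
    by metis
  have cinner: "cinner y y' = cinner x x'" if G: "G x y" "G x' y'" for x y x' y'
  proof -
    obtain X Y where XY: "\<And>n. paired g h I (X n) (Y n)" "X \<longlonglongrightarrow> x" "Y \<longlonglongrightarrow> y"
      using G(1) unfolding G_def by auto
    obtain X' Y' where XY': "\<And>n. paired g h I (X' n) (Y' n)" "X' \<longlonglongrightarrow> x'" "Y' \<longlonglongrightarrow> y'"
      using G(2) unfolding G_def by auto
    have "(\<lambda>n. cinner (Y n) (Y' n)) \<longlonglongrightarrow> cinner y y'" "(\<lambda>n. cinner (X n) (X' n)) \<longlonglongrightarrow> cinner x x'"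
      using XY XY' by (auto intro: bounded_bilinear.tendsto[OF bounded_bilinear_cinner])
    then show ?thesis
      using LIMSEQ_unique by (simp add: paired_cinner[OF gh XY(1) XY'(1)])
  qed
  have add: "G (x + x') (y + y')" if G: "G x y" "G x' y'" for x y x' y'
  proof -
    obtain X Y where XY: "\<And>n. paired g h I (X n) (Y n)" "X \<longlonglongrightarrow> x" "Y \<longlonglongrightarrow> y"
      using G(1) unfolding G_def by auto
    obtain X' Y' where XY': "\<And>n. paired g h I (X' n) (Y' n)" "X' \<longlonglongrightarrow> x'" "Y' \<longlonglongrightarrow> y'"
      using G(2) unfolding G_def by auto
    show ?thesis
      by (rule GI[OF paired_add[OF XY'(1) XY(1)] tendsto_add[OF XY(2) XY'(2)] tendsto_add[OF XY(3) XY'(3)]])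
  qed
  have scale: "G (c *\<^sub>C x) (c *\<^sub>C y)" if G: "G x y" for c x y
  proof -
    obtain X Y where XY: "\<And>n. paired g h I (X n) (Y n)" "X \<longlonglongrightarrow> x" "Y \<longlonglongrightarrow> y"
      using G unfolding G_def by auto
    show ?thesis
      by (rule GI[OF paired_scaleC[OF XY(1)] tendsto_scaleC[OF XY(2)] tendsto_scaleC[OF XY(3)]])
  qed
  have unique: "y = y'" if G: "G x y" "G x y'" for x y y'
  proof -
    \<comment> \<open>Both values are images of \<open>x\<close>, so their difference is an image of
      0 and has norm 0.\<close>
    have "G (x - x) (y - y')"
      using add[OF G(1) scale[OF G(2), of "-1"]] by (simp add: complex_vector.scale_minus_left)
    from cinner[OF this this] show ?thesis by simp
  qed
  have "bounded_clinear W"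
  proof (rule bounded_clinearI[where K = 1])
    show "W (x + y) = W x + W y" for x y
      by (rule unique[OF W add[OF W W]])
    show "W (c *\<^sub>C x) = c *\<^sub>C W x" for c x
      by (rule unique[OF W scale[OF W]])
    show "norm (W x) \<le> 1 * norm x" for x
      using norm_eq_cinner[OF cinner[OF W W], of x] by simp
  qed
  then have "isometry_op W"
    unfolding isometry_op_def using cinner[OF W W] by simp
  moreover have "W (g i) = h i" if "i \<in> I" for i
    by (rule unique[OF W]) (auto simp: G_def intro!: exI[of _ "\<lambda>_. g i"] exI[of _ "\<lambda>_. h i"] paired_base that)
  ultimately show thesis
    using that by blast
qed

section \<open>Tensor products\<close>

lemma subspace_closure_cspan: "complex_vector.subspace (closure (cspan S))"
proof (rule complex_vector.subspaceI)
  show "0 \<in> closure (cspan S)"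
    using closure_subset complex_vector.span_zero by blast
  fix x y c assume "x \<in> closure (cspan S)"
  then obtain X where X: "\<And>n. X n \<in> cspan S" "X \<longlonglongrightarrow> x"
    unfolding closure_sequential by blast
  show "c *\<^sub>C x \<in> closure (cspan S)"
    unfolding closure_sequential
    by (rule exI[of _ "\<lambda>n. c *\<^sub>C X n"])
      (auto intro: X complex_vector.span_scale tendsto_scaleC)
  assume "y \<in> closure (cspan S)"
  then obtain Y where Y: "\<And>n. Y n \<in> cspan S" "Y \<longlonglongrightarrow> y"
    unfolding closure_sequential by blast
  show "x + y \<in> closure (cspan S)"
    unfolding closure_sequential
    by (rule exI[of _ "\<lambda>n. X n + Y n"]) (auto intro: X Y complex_vector.span_add tendsto_add)
qed

text \<open>The preimage of a closed subspace under a continuous linear map is a closed subspace.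
  Applied to \<open>t\<close> with one argument fixed, this refines the generators of a tensor
  product factor by factor.\<close>

lemma bounded_clinear_image_dense:
  assumes A: "bounded_clinear A" and S: "closure (cspan S) = UNIV"
    and AS: "\<And>x. x \<in> S \<Longrightarrow> A x \<in> closure (cspan T)"
  shows "A x \<in> closure (cspan T)"
proof -
  have "A x \<in> closure (cspan T)" if "x \<in> cspan S" for x
    using that
  proof (induction rule: complex_vector.span_induct_alt)
    case base
    show ?case
      by (simp add: bounded_clinear_zero[OF A] complex_vector.subspace_0[OF subspace_closure_cspan])
  next
    case (step c x y)
    then show ?case
      by (simp add: bounded_clinear_add[OF A] bounded_clinear_scaleC[OF A] AS
          complex_vector.subspace_add complex_vector.subspace_scale subspace_closure_cspan)
  qed
  then have "A ` closure (cspan S) \<subseteq> closure (cspan T)"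
    by (intro image_closure_subset bounded_linear.continuous_on[OF bounded_clinear_bounded_linear[OF A]])
      (auto simp: continuous_on_id)
  then show ?thesis
    using S by auto
qed

lemma dense_superset:
  assumes "closure (cspan S) = UNIV" "S \<subseteq> closure (cspan T)"
  shows "closure (cspan T) = UNIV"
  using bounded_clinear_image_dense[OF bounded_clinear_id assms(1), of T] assms(2) by auto

section \<open>Tensor products of two spaces\<close>

lemma tensor_product_cinner:
  "is_tensor_product t \<Longrightarrow> cinner (t x y) (t x' y') = cinner x x' * cinner y y'"
  by (simp add: is_tensor_product_def)

lemma norm_tensor_product:
  assumes "is_tensor_product t"
  shows "norm (t x y) = norm x * norm y"
proof -
  have "complex_of_real ((norm (t x y))\<^sup>2) = complex_of_real ((norm x * norm y)\<^sup>2)"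
    unfolding power_mult_distrib of_real_mult
    by (simp only: cinner_self[symmetric] tensor_product_cinner[OF assms])
  then have "(norm (t x y))\<^sup>2 = (norm x * norm y)\<^sup>2"
    by (simp only: of_real_eq_iff)
  then show ?thesis
    by (simp add: power2_eq_iff_nonneg)
qed

lemma bounded_clinear_tensor_right: "is_tensor_product t \<Longrightarrow> bounded_clinear (t x)"
  by (rule bounded_clinearI[where K = "norm x"])
    (simp_all add: norm_tensor_product, simp_all add: is_tensor_product_def)

lemma bounded_clinear_tensor_left: "is_tensor_product t \<Longrightarrow> bounded_clinear (\<lambda>x. t x y)"
  by (rule bounded_clinearI[where K = "norm y"])
    (simp_all add: norm_tensor_product mult.commute, simp_all add: is_tensor_product_def)

lemma tensor_product_dense: "is_tensor_product t \<Longrightarrow> closure (cspan (range (\<lambda>(x, y). t x y))) = UNIV"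
  by (simp add: is_tensor_product_def)

lemma tensor_product_dense_left:
  assumes t: "is_tensor_product t" and S: "closure (cspan S) = UNIV"
  shows "closure (cspan ((\<lambda>(x, y). t x y) ` (S \<times> UNIV))) = UNIV"
proof (rule dense_superset[OF tensor_product_dense[OF t]])
  have "t x y \<in> closure (cspan ((\<lambda>(x, y). t x y) ` (S \<times> UNIV)))" for x y
    by (rule bounded_clinear_image_dense[OF bounded_clinear_tensor_left[OF t] S],
        rule subsetD[OF closure_subset], rule complex_vector.span_base) auto
  then show "range (\<lambda>(x, y). t x y) \<subseteq> closure (cspan ((\<lambda>(x, y). t x y) ` (S \<times> UNIV)))"
    by auto
qed

lemma tensor_product_dense_right:
  assumes t: "is_tensor_product t" and S: "closure (cspan S) = UNIV"
  shows "closure (cspan ((\<lambda>(x, y). t x y) ` (UNIV \<times> S))) = UNIV"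
proof (rule dense_superset[OF tensor_product_dense[OF t]])
  have "t x y \<in> closure (cspan ((\<lambda>(x, y). t x y) ` (UNIV \<times> S)))" for x y
    by (rule bounded_clinear_image_dense[OF bounded_clinear_tensor_right[OF t] S],
        rule subsetD[OF closure_subset], rule complex_vector.span_base) auto
  then show "range (\<lambda>(x, y). t x y) \<subseteq> closure (cspan ((\<lambda>(x, y). t x y) ` (UNIV \<times> S)))"
    by auto
qed

lemma tensor_op_eqI:
  assumes t: "is_tensor_product t" and W: "bounded_clinear W" "\<And>x y. W (t x y) = t (A x) (B y)"
  shows "tensor_op t A B = W"
  unfolding tensor_op_def
proof (rule the_equality)
  show "W' = W" if "bounded_clinear W' \<and> (\<forall>x y. W' (t x y) = t (A x) (B y))" for W'
    by (rule bounded_clinear_eq_on_dense[OF _ W(1) tensor_product_dense[OF t]]) (use that W in auto)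
qed (use W in blast)

text \<open>Identifies \<open>cadjoint (t u)\<close> as the contraction <u| tensor 1, the building
  block of partial traces.\<close>

lemma cadjoint_tensor:
  assumes t: "is_tensor_product t"
  shows "cadjoint (t u) (t x y) = cinner u x *\<^sub>C y"
  by (rule cinner_ext)
    (simp add: cinner_cadjoint_right[OF bounded_clinear_tensor_right[OF t]]
      tensor_product_cinner[OF t] cinner_scaleC_right)

lemma tensor_op_ketbra:
  assumes t: "is_tensor_product t" and B: "bounded_clinear B"
  shows "tensor_op t (ketbra u) B (t x y) = t (cinner u x *\<^sub>C u) (B y)"
proof -
  note tr = bounded_clinear_tensor_right[OF t]
  \<comment> \<open>The witness contracts the first factor with \<open>u\<close>, applies
    \<open>B\<close> and tensors with \<open>u\<close> again; it is bounded by construction.\<close>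
  have "tensor_op t (ketbra u) B = (\<lambda>z. t u (B (cadjoint (t u) z)))"
  proof (rule tensor_op_eqI[OF t])
    show "bounded_clinear (\<lambda>z. t u (B (cadjoint (t u) z)))"
      by (intro bounded_clinear_compose[OF tr] bounded_clinear_compose[OF B] bounded_clinear_cadjoint tr)
    show "t u (B (cadjoint (t u) (t x y))) = t (ketbra u x) (B y)" for x y
      by (simp add: cadjoint_tensor[OF t] bounded_clinear_scaleC[OF B] bounded_clinear_scaleC[OF tr]
          ketbra_def bounded_clinear_scaleC[OF bounded_clinear_tensor_left[OF t]])
  qed
  then show ?thesis
    by (simp add: cadjoint_tensor[OF t] bounded_clinear_scaleC[OF B] bounded_clinear_scaleC[OF tr]
        bounded_clinear_scaleC[OF bounded_clinear_tensor_left[OF t]])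
qed

lemma square_summable_tensor:
  assumes t: "is_tensor_product t" and v: "square_summable v I" and w: "square_summable w J"
  shows "square_summable (\<lambda>(i, j). t (v i) (w j)) (I \<times> J)"
proof (rule summable_on_SigmaI)
  show "((\<lambda>j. (norm (case (i, j) of (i, j) \<Rightarrow> t (v i) (w j)))\<^sup>2) has_sum
      (norm (v i))\<^sup>2 * (\<Sum>\<^sub>\<infinity>j\<in>J. (norm (w j))\<^sup>2)) J" for i
    using has_sum_cmult_right[OF has_sum_infsum[OF w], of "(norm (v i))\<^sup>2"]
    by (simp add: norm_tensor_product[OF t] power_mult_distrib)
qed (simp_all add: summable_on_cmult_left[OF v])

text \<open>On an elementary tensor the double series is summed over \<open>j\<close> and then over
  \<open>i\<close>, using continuity of \<open>t\<close> in each argument separately.\<close>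

lemma tensor_op_mixture:
  assumes t: "is_tensor_product t" and v: "square_summable v I" and w: "square_summable w J"
  shows "tensor_op t (mixture v I) (mixture w J) = mixture (\<lambda>(i, j). t (v i) (w j)) (I \<times> J)"
proof (rule tensor_op_eqI[OF t])
  note vw = square_summable_tensor[OF t v w]
  note tr = bounded_clinear_tensor_right[OF t] and tl = bounded_clinear_tensor_left[OF t]
  show "bounded_clinear (mixture (\<lambda>(i, j). t (v i) (w j)) (I \<times> J))"
    by (rule bounded_clinear_mixture[OF vw])
  fix x y
  have "((\<lambda>i. t (cinner (v i) x *\<^sub>C v i) (mixture w J y)) has_sum
      mixture (\<lambda>(i, j). t (v i) (w j)) (I \<times> J) (t x y)) I"
  proof (rule has_sum_SigmaD[OF mixture_has_sum[OF vw]])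
    fix i
    have "((\<lambda>j. t (cinner (v i) x *\<^sub>C v i) (cinner (w j) y *\<^sub>C w j)) has_sum
        t (cinner (v i) x *\<^sub>C v i) (mixture w J y)) J"
      by (rule bounded_clinear_has_sum[OF tr mixture_has_sum[OF w]])
    then show "((\<lambda>j. cinner (case (i, j) of (i, j) \<Rightarrow> t (v i) (w j)) (t x y) *\<^sub>C
        (case (i, j) of (i, j) \<Rightarrow> t (v i) (w j))) has_sum
        t (cinner (v i) x *\<^sub>C v i) (mixture w J y)) J"
      by (simp add: tensor_product_cinner[OF t] bounded_clinear_scaleC[OF tr]
          bounded_clinear_scaleC[OF tl] scaleC_scaleC mult.commute)
  qed
  moreover have "((\<lambda>i. t (cinner (v i) x *\<^sub>C v i) (mixture w J y)) has_sum
      t (mixture v I x) (mixture w J y)) I"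
    by (rule bounded_clinear_has_sum[OF tl mixture_has_sum[OF v]])
  ultimately show "mixture (\<lambda>(i, j). t (v i) (w j)) (I \<times> J) (t x y) = t (mixture v I x) (mixture w J y)"
    by (rule has_sum_unique)
qed

text \<open>Bessel's inequality with vector coefficients (<e_i| tensor 1) z: again \<open>z\<close>
  is compared with its projection \<open>s\<close>.\<close>

lemma bessel_tensor:
  assumes t: "is_tensor_product t"
    and on: "\<And>i j. i \<in> I \<Longrightarrow> j \<in> I \<Longrightarrow> cinner (e i) (e j) = (if i = j then 1 else 0)"
    and F: "finite F" "F \<subseteq> I"
  shows "(\<Sum>i\<in>F. (norm (cadjoint (t (e i)) z))\<^sup>2) \<le> (norm z)\<^sup>2"
proof -
  note tr = bounded_clinear_tensor_right[OF t]
  define y where "y i = cadjoint (t (e i)) z" for i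
  define s where "s = (\<Sum>i\<in>F. t (e i) (y i))"
  have "cinner (t (e i) (y i)) s = complex_of_real ((norm (y i))\<^sup>2)" if "i \<in> F" for i
  proof -
    have "cinner (t (e i) (y i)) s = (\<Sum>j\<in>F. if i = j then cinner (y i) (y i) else 0)"
      unfolding s_def cinner_sum_right
      by (intro sum.cong refl) (use that F on in \<open>auto simp: tensor_product_cinner[OF t] subset_iff\<close>)
    then show ?thesis
      using that F(1) by (simp add: cinner_self)
  qed
  then have "cinner s s = complex_of_real (\<Sum>i\<in>F. (norm (y i))\<^sup>2)"
    by (subst (1) s_def) (simp add: cinner_sum_left)
  then have s: "(norm s)\<^sup>2 = (\<Sum>i\<in>F. (norm (y i))\<^sup>2)"
    unfolding cinner_self of_real_eq_iff .
  have "cinner z (t (e i) (y i)) = complex_of_real ((norm (y i))\<^sup>2)" for i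
    unfolding cinner_self[symmetric] by (subst (2) y_def) (rule cinner_cadjoint[OF tr, symmetric])
  then have "cinner z s = complex_of_real ((norm s)\<^sup>2)"
    by (simp add: s_def[THEN arg_cong[where f = "cinner z"]] cinner_sum_right s)
  then have "norm s * norm s \<le> norm z * norm s"
    using norm_cinner_le[of z s] by (simp add: power2_eq_square norm_mult)
  then have "norm s \<le> norm z"
    by (cases "norm s = 0") (auto simp: mult_le_cancel_right)
  from power_mono[OF this norm_ge_zero, of 2] show ?thesis
    unfolding s y_def .
qed

text \<open>For each \<open>i\<close> the sum over \<open>b\<close> is at most the squared norm of
  \<open>w i\<close> by \<open>bessel_tensor\<close>; the order of summation is swapped
  afterwards.\<close>

lemma square_summable_partial_trace:
  assumes t: "is_tensor_product t" and w: "square_summable w I"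
  shows "square_summable (\<lambda>(b, i). cadjoint (t b) (w i)) (some_basis \<times> I)"
proof -
  let ?B = "some_basis :: 'a set"
  note on = orthonormal_basis_cinner[OF some_basis]
  have bound: "(\<Sum>b\<in>F. (norm (cadjoint (t b) z))\<^sup>2) \<le> (norm z)\<^sup>2" if "finite F" "F \<subseteq> ?B" for F z
    by (rule bessel_tensor[OF t on that])
  have sum: "(\<lambda>b. (norm (cadjoint (t b) z))\<^sup>2) summable_on ?B" for z
    by (rule nonneg_bdd_above_summable_on) (auto intro!: bdd_aboveI2[where M = "(norm z)\<^sup>2"] bound)
  have "(\<lambda>(i, b). (norm (cadjoint (t b) (w i)))\<^sup>2) summable_on I \<times> ?B"
  proof (rule summable_on_SigmaI)
    show "((\<lambda>b. case (i, b) of (i, b) \<Rightarrow> (norm (cadjoint (t b) (w i)))\<^sup>2) has_sum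
        (\<Sum>\<^sub>\<infinity>b\<in>?B. (norm (cadjoint (t b) (w i)))\<^sup>2)) ?B" for i
      by (simp add: sum)
    show "(\<lambda>i. \<Sum>\<^sub>\<infinity>b\<in>?B. (norm (cadjoint (t b) (w i)))\<^sup>2) summable_on I"
      by (rule summable_on_comparison_test[OF w])
        (auto intro!: infsum_le_finite_sums infsum_nonneg sum bound)
  qed auto
  then show ?thesis
    by (subst summable_on_swap) (simp add: case_prod_unfold)
qed

text \<open>Contracting each |w_i><w_i| with each basis vector \<open>b\<close> gives the required
  matrix elements, and matrix elements determine an operator.\<close>

lemma partial_trace_mixture:
  assumes t: "is_tensor_product t" and w: "square_summable w I"
  shows "partial_trace t (mixture w I) = mixture (\<lambda>(b, i). cadjoint (t b) (w i)) (some_basis \<times> I)"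
    (is "_ = ?S")
  unfolding partial_trace_def
proof (rule the_equality)
  note sq = square_summable_partial_trace[OF t w] and tr = bounded_clinear_tensor_right[OF t]
  have S: "cinner x (?S y) = (\<Sum>\<^sub>\<infinity>b\<in>some_basis. cinner (t b x) (mixture w I (t b y)))" for x y
  proof (rule infsumI[symmetric], rule has_sum_SigmaD)
    let ?s = "\<lambda>(b, i). cadjoint (t b) (w i)"
    show "((\<lambda>p. cinner x (cinner (?s p) y *\<^sub>C ?s p)) has_sum cinner x (?S y)) (some_basis \<times> I)"
      by (rule bounded_clinear_has_sum[OF bounded_clinear_cinner mixture_has_sum[OF sq]])
    fix b
    have "((\<lambda>i. cinner (t b x) (cinner (w i) (t b y) *\<^sub>C w i)) has_sum
        cinner (t b x) (mixture w I (t b y))) I"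
      by (rule bounded_clinear_has_sum[OF bounded_clinear_cinner mixture_has_sum[OF w]])
    then show "((\<lambda>i. cinner x (cinner (?s (b, i)) y *\<^sub>C ?s (b, i))) has_sum
        cinner (t b x) (mixture w I (t b y))) I"
      by (simp add: cinner_scaleC_right cinner_cadjoint[OF tr] cinner_cadjoint_right[OF tr])
  qed
  then show "bounded_clinear ?S \<and> (\<forall>x y. cinner x (?S y) =
      (\<Sum>\<^sub>\<infinity>b\<in>some_basis. cinner (t b x) (mixture w I (t b y))))"
    by (simp add: bounded_clinear_mixture[OF sq])
  show "S' = ?S" if "bounded_clinear S' \<and> (\<forall>x y. cinner x (S' y) =
      (\<Sum>\<^sub>\<infinity>b\<in>some_basis. cinner (t b x) (mixture w I (t b y))))" for S'
    by (rule ext, rule cinner_ext) (use that S in simp)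
qed

section \<open>Tensor powers\<close>

lemma tensor_power_cinner: "is_tensor_power n t \<Longrightarrow> cinner (t x) (t y) = (\<Prod>i<n. cinner (x i) (y i))"
  by (simp add: is_tensor_power_def)

lemma tensor_power_dense: "is_tensor_power n t \<Longrightarrow> closure (cspan (range t)) = UNIV"
  by (simp add: is_tensor_power_def)

text \<open>Inner products with elementary tensors, which have a dense span, see only the indices
  below \<open>n\<close>.\<close>

lemma tensor_power_cong:
  assumes t: "is_tensor_power n t" and "\<And>i. i < n \<Longrightarrow> x i = y i"
  shows "t x = t y"
  by (rule cinner_ext_dense[OF tensor_power_dense[OF t]])
    (auto simp: tensor_power_cinner[OF t] assms(2) intro!: prod.cong)

text \<open>The isometry may depend on the position, which covers both an operator on a single copy
  and a full tensor power.\<close>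

lemma tensor_power_isometry:
  assumes t: "is_tensor_power n t" and A: "\<And>i. isometry_op (A i)"
  obtains W where "isometry_op W" "\<And>x. W (t x) = t (\<lambda>i. A i (x i))"
proof -
  obtain W where "isometry_op W" "\<And>x. x \<in> UNIV \<Longrightarrow> W (t x) = t (\<lambda>i. A i (x i))"
    by (rule isometry_extension[of UNIV "\<lambda>x. t (\<lambda>i. A i (x i))" t])
      (simp_all add: tensor_power_cinner[OF t] isometry_op_cinner[OF A] tensor_power_dense[OF t])
  then show thesis
    using that by simp
qed

lemma power_op_eqI:
  assumes t: "is_tensor_power n t" and W: "bounded_clinear W" "\<And>x. W (t x) = t (\<lambda>i. A (x i))"
  shows "power_op t A = W"
  unfolding power_op_def
proof (rule the_equality)
  show "W' = W" if "bounded_clinear W' \<and> (\<forall>x. W' (t x) = t (\<lambda>i. A (x i)))" for W'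
    by (rule bounded_clinear_eq_on_dense[OF _ W(1) tensor_power_dense[OF t]]) (use that W in auto)
qed (use W in blast)

lemma power_op_isometry:
  assumes t: "is_tensor_power n t" and A: "isometry_op A"
  shows "isometry_op (power_op t A)" and "power_op t A (t x) = t (\<lambda>i. A (x i))"
proof -
  obtain W where W: "isometry_op W" "\<And>x. W (t x) = t (\<lambda>i. A (x i))"
    using tensor_power_isometry[OF t, of "\<lambda>_. A", OF A] by blast
  moreover have "power_op t A = W"
    by (rule power_op_eqI[OF t]) (simp_all add: W isometry_op_bounded_clinear)
  ultimately show "isometry_op (power_op t A)" "power_op t A (t x) = t (\<lambda>i. A (x i))"
    by simp_all
qed

text \<open>Matrix elements between product vectors agree factor by factor. This puts
  \<open>memoryless_channel\<close> into the form W T W* needed for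
  \<open>mixture_conjugate\<close>.\<close>

lemma power_op_cadjoint:
  assumes t: "is_tensor_power n t" and V: "unitary_op V"
  shows "power_op t (cadjoint V) = cadjoint (power_op t V)"
proof (rule bounded_clinear_eq_on_dense[OF _ _ tensor_power_dense[OF t]])
  note iso = unitary_isometry_op[OF V]
  note bc = isometry_op_bounded_clinear[OF power_op_isometry(1)[OF t iso(1)]]
  show "bounded_clinear (power_op t (cadjoint V))"
    by (rule isometry_op_bounded_clinear[OF power_op_isometry(1)[OF t iso(2)]])
  show "bounded_clinear (cadjoint (power_op t V))"
    by (rule bounded_clinear_cadjoint[OF bc])
  fix z assume "z \<in> range t"
  then obtain y where z: "z = t y" by auto
  show "power_op t (cadjoint V) z = cadjoint (power_op t V) z"
  proof (rule cinner_ext_dense[OF tensor_power_dense[OF t]])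
    fix w assume "w \<in> range t"
    then obtain x where w: "w = t x" by auto
    show "cinner w (power_op t (cadjoint V) z) = cinner w (cadjoint (power_op t V) z)"
      by (simp add: w z cinner_cadjoint_right[OF bc] power_op_isometry(2)[OF t] iso
          tensor_power_cinner[OF t] cinner_cadjoint_right[OF isometry_op_bounded_clinear[OF iso(1)]])
  qed
qed

section \<open>Controlled memory devices\<close>

text \<open>Gram entries of the generators \<open>t (e l) y\<close> with different \<open>l\<close>
  vanish before and after the map; for equal \<open>l\<close> the isometry \<open>A l\<close>
  preserves them.\<close>

lemma controlled_isometry:
  fixes t :: "'m::complex_hilbert_space \<Rightarrow> 'h::complex_hilbert_space \<Rightarrow> 'c::complex_hilbert_space"
  assumes t: "is_tensor_product t" and e: "orthonormal_basis e L"
    and A: "\<And>l. l \<in> L \<Longrightarrow> isometry_op (A l)"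
  obtains W where "isometry_op W" "\<And>l y. l \<in> L \<Longrightarrow> W (t (e l) y) = t (e l) (A l y)"
proof -
  have "(\<lambda>(l, y). t (e l) y) ` (L \<times> UNIV) = (\<lambda>(x, y). t x y) ` (e ` L \<times> UNIV)"
    by force
  then have dense: "closure (cspan ((\<lambda>(l, y). t (e l) y) ` (L \<times> UNIV))) = UNIV"
    using tensor_product_dense_left[OF t orthonormal_basis_dense[OF e]] by simp
  obtain W where W: "isometry_op W"
    "\<And>p. p \<in> L \<times> UNIV \<Longrightarrow> W (case p of (l, y) \<Rightarrow> t (e l) y) = (case p of (l, y) \<Rightarrow> t (e l) (A l y))"
  proof (rule isometry_extension[OF _ dense, where h = "\<lambda>(l, y). t (e l) (A l y)"])
    fix p q assume "p \<in> L \<times> (UNIV :: 'h set)" "q \<in> L \<times> (UNIV :: 'h set)"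
    then show "cinner (case p of (l, y) \<Rightarrow> t (e l) (A l y)) (case q of (l, y) \<Rightarrow> t (e l) (A l y)) =
        cinner (case p of (l, y) \<Rightarrow> t (e l) y) (case q of (l, y) \<Rightarrow> t (e l) y)"
      by (auto simp: tensor_product_cinner[OF t] orthonormal_basis_cinner[OF e] isometry_op_cinner[OF A])
  qed blast
  have "W (t (e l) y) = t (e l) (A l y)" if "l \<in> L" for l y
    using W(2)[of "(l, y)"] that by simp
  then show thesis
    using that W(1) by blast
qed

text \<open>Expanding \<open>x\<close> in the basis \<open>e\<close> turns the series into that of
  \<open>W (t x y)\<close>. Agreement on elementary tensors suffices, since \<open>use_op\<close>
  evaluates its operator only there.\<close>

lemma controlled_op_tensor:
  assumes t: "is_tensor_product t" and e: "orthonormal_basis e L"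
    and V: "\<And>l. l \<in> L \<Longrightarrow> bounded_clinear (V l)"
    and W: "bounded_clinear W" "\<And>l y. l \<in> L \<Longrightarrow> W (t (e l) y) = t (e l) (V l y)"
  shows "controlled_op t e L V (t x y) = W (t x y)"
  unfolding controlled_op_def
proof (rule infsumI)
  have "((\<lambda>l. W (t (cinner (e l) x *\<^sub>C e l) y)) has_sum W (t x y)) L"
    by (rule bounded_clinear_has_sum[OF bounded_clinear_compose[OF W(1)
            bounded_clinear_tensor_left[OF t]] orthonormal_basis_expansion[OF e]])
  then show "((\<lambda>l. tensor_op t (ketbra (e l)) (V l) (t x y)) has_sum W (t x y)) L"
    by (rule has_sum_cong[THEN iffD1, rotated])
      (simp add: tensor_op_ketbra[OF t V] W(2) bounded_clinear_scaleC[OF W(1)]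
        bounded_clinear_scaleC[OF bounded_clinear_tensor_left[OF t]])
qed

lemma use_op_controlled:
  fixes tMH :: "'m::complex_hilbert_space \<Rightarrow> 'h::complex_hilbert_space \<Rightarrow> 'mh::complex_hilbert_space"
    and tn :: "(nat \<Rightarrow> 'h) \<Rightarrow> 'hn::complex_hilbert_space"
    and tM :: "'m \<Rightarrow> 'hn \<Rightarrow> 'mhn::complex_hilbert_space"
  assumes tMH: "is_tensor_product tMH" and tn: "is_tensor_power n tn" and tM: "is_tensor_product tM"
    and e: "orthonormal_basis e L" and V: "\<And>l. l \<in> L \<Longrightarrow> isometry_op (V l)"
    and k: "k < n"
    and A: "\<And>l. l \<in> L \<Longrightarrow> isometry_op (A l)"
      "\<And>l x. l \<in> L \<Longrightarrow> A l (tn x) = tn (x(k := V l (x k)))"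
  defines "W \<equiv> use_op tMH tn tM n (controlled_op tMH e L V) k"
  shows "bounded_clinear W" and "\<And>l y. l \<in> L \<Longrightarrow> W (tM (e l) y) = tM (e l) (A l y)"
proof -
  define U where "U = controlled_op tMH e L V"
  \<comment> \<open>\<open>Z\<close> is the candidate for the described operator; \<open>C\<close>
    is a bounded stand-in for the series \<open>U\<close>.\<close>
  obtain Z where Z: "isometry_op Z" "\<And>l y. l \<in> L \<Longrightarrow> Z (tM (e l) y) = tM (e l) (A l y)"
    using controlled_isometry[OF tM e, of A, OF A(1)] by blast
  obtain C where C: "isometry_op C" "\<And>l y. l \<in> L \<Longrightarrow> C (tMH (e l) y) = tMH (e l) (V l y)"
    using controlled_isometry[OF tMH e, of V, OF V] by blast
  note bZ = isometry_op_bounded_clinear[OF Z(1)] and bC = isometry_op_bounded_clinear[OF C(1)]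
  have U: "U (tMH m y) = C (tMH m y)" for m y
    unfolding U_def
    by (rule controlled_op_tensor[where V = V and W = C, OF tMH e _ bC])
      (simp_all add: C(2) isometry_op_bounded_clinear[OF V])
  have elements: "cinner (tM m' (tn x')) (Z (tM m (tn x))) =
      cinner (tMH m' (x' k)) (U (tMH m (x k))) * (\<Prod>i\<in>{..<n} - {k}. cinner (x' i) (x i))" for m x m' x'
  proof -
    let ?P = "\<Prod>i\<in>{..<n} - {k}. cinner (x' i) (x i)"
    \<comment> \<open>Both sides are bounded and linear in \<open>m\<close>, so it suffices to take
      \<open>m = e l\<close>, where \<open>Z\<close> and \<open>C\<close> act through
      \<open>A l\<close> and \<open>V l\<close>.\<close>
    have "(\<lambda>m. cinner (tM m' (tn x')) (Z (tM m (tn x)))) = (\<lambda>m. cinner (tMH m' (x' k)) (C (tMH m (x k))) * ?P)"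
    proof (rule bounded_clinear_eq_on_dense[OF _ _ orthonormal_basis_dense[OF e]])
      show "bounded_clinear (\<lambda>m. cinner (tM m' (tn x')) (Z (tM m (tn x))))"
        by (rule bounded_clinear_cinner_right,
            rule bounded_clinear_compose[OF bZ bounded_clinear_tensor_left[OF tM]])
      show "bounded_clinear (\<lambda>m. cinner (tMH m' (x' k)) (C (tMH m (x k))) * ?P)"
        by (rule bounded_clinear_compose[OF bounded_clinear_cmult_right], rule bounded_clinear_cinner_right,
            rule bounded_clinear_compose[OF bC bounded_clinear_tensor_left[OF tMH]])
      fix m assume "m \<in> e ` L"
      then obtain l where l: "l \<in> L" "m = e l" by auto
      have "cinner (tn x') (tn (x(k := V l (x k)))) = (\<Prod>i<n. cinner (x' i) ((x(k := V l (x k))) i))"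
        by (rule tensor_power_cinner[OF tn])
      also have "\<dots> = cinner (x' k) (V l (x k)) * (\<Prod>i\<in>{..<n} - {k}. cinner (x' i) ((x(k := V l (x k))) i))"
        using k by (subst prod.remove[of _ k]) auto
      also have "(\<Prod>i\<in>{..<n} - {k}. cinner (x' i) ((x(k := V l (x k))) i)) = ?P"
        by (intro prod.cong) auto
      finally show "cinner (tM m' (tn x')) (Z (tM m (tn x))) = cinner (tMH m' (x' k)) (C (tMH m (x k))) * ?P"
        by (simp add: l Z(2) C(2) A(2) tensor_product_cinner[OF tM] tensor_product_cinner[OF tMH]
            del: fun_upd_apply)
    qed
    then show ?thesis
      unfolding U by (rule fun_cong)
  qed
  have "W = Z"
    unfolding W_def use_op_def U_def[symmetric]
  proof (rule the_equality)
    fix W' assume W': "bounded_clinear W' \<and> (\<forall>m x m' x'. cinner (tM m' (tn x')) (W' (tM m (tn x))) =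
        cinner (tMH m' (x' k)) (U (tMH m (x k))) * (\<Prod>i\<in>{..<n} - {k}. cinner (x' i) (x i)))"
    note dense = tensor_product_dense_right[OF tM tensor_power_dense[OF tn]]
    show "W' = Z"
    proof (rule bounded_clinear_eq_on_dense[OF _ bZ dense])
      fix z assume z: "z \<in> (\<lambda>(x, y). tM x y) ` (UNIV \<times> range tn)"
      show "W' z = Z z"
        by (rule cinner_ext_dense[OF dense]) (use z W' elements in auto)
    qed (use W' in blast)
  qed (use bZ elements in blast)
  then show "bounded_clinear W" "\<And>l y. l \<in> L \<Longrightarrow> W (tM (e l) y) = tM (e l) (A l y)"
    using bZ Z(2) by simp_all
qed

text \<open>The product of the first \<open>k\<close> operators, index 0 acting first:
  \<open>evolve\<close> conjugates by it.\<close>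

primrec compose_upto :: "(nat \<Rightarrow> 'a \<Rightarrow> 'a) \<Rightarrow> nat \<Rightarrow> 'a \<Rightarrow> 'a" where
  "compose_upto W 0 = (\<lambda>x. x)"
| "compose_upto W (Suc k) = (\<lambda>x. W k (compose_upto W k x))"

lemma bounded_clinear_compose_upto:
  "(\<And>k. k < n \<Longrightarrow> bounded_clinear (W k)) \<Longrightarrow> bounded_clinear (compose_upto W n)"
  by (induction n) (auto intro: bounded_clinear_id bounded_clinear_compose)

lemma evolve_mixture:
  assumes v: "square_summable v I" and W: "\<And>k. k < n \<Longrightarrow> bounded_clinear (W k)"
  shows "evolve W n (mixture v I) = mixture (\<lambda>i. compose_upto W n (v i)) I"
  using W
proof (induction n)
  case (Suc n)
  have n: "bounded_clinear (W n)" and F: "bounded_clinear (compose_upto W n)"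
    using Suc.prems by (auto intro: bounded_clinear_compose_upto)
  then show ?case
    using Suc mixture_conjugate[OF n square_summable_image[OF F v]]
    by (simp add: cinner_cadjoint_right[OF n])
qed simp

lemma compose_upto_power_op:
  assumes tn: "is_tensor_power n tn" and V: "isometry_op V"
    and A: "\<And>k. k < n \<Longrightarrow> isometry_op (A k)" "\<And>k x. k < n \<Longrightarrow> A k (tn x) = tn (x(k := V (x k)))"
  shows "compose_upto A n = power_op tn V"
proof (rule power_op_eqI[OF tn, symmetric])
  show "bounded_clinear (compose_upto A n)"
    by (intro bounded_clinear_compose_upto isometry_op_bounded_clinear A(1))
  \<comment> \<open>After \<open>m\<close> uses exactly the copies with index below \<open>m\<close>
    have been transformed.\<close>
  have "m \<le> n \<Longrightarrow> compose_upto A m (tn x) = tn (\<lambda>i. if i < m then V (x i) else x i)" for m x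
  proof (induction m)
    case (Suc m)
    then show ?case
      by (auto simp: A(2) less_Suc_eq intro!: arg_cong[where f = tn])
  qed simp
  then have "compose_upto A n (tn x) = tn (\<lambda>i. if i < n then V (x i) else x i)" for x
    by simp
  \<comment> \<open>The entries from \<open>n\<close> on differ, but \<open>tn\<close> ignores
    them.\<close>
  also have "tn (\<lambda>i. if i < n then V (x i) else x i) = tn (\<lambda>i. V (x i))" for x
    by (rule tensor_power_cong[OF tn]) simp
  finally show "compose_upto A n (tn x) = tn (\<lambda>i. V (x i))" for x .
qed

text \<open>A memory basis vector \<open>e l\<close> is left unchanged by every use, so the same
  \<open>V l\<close> acts on each copy.\<close>

lemma controlled_device_action:
  fixes tMH :: "'m::complex_hilbert_space \<Rightarrow> 'h::complex_hilbert_space \<Rightarrow> 'mh::complex_hilbert_space"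
    and tn :: "(nat \<Rightarrow> 'h) \<Rightarrow> 'hn::complex_hilbert_space"
    and tM :: "'m \<Rightarrow> 'hn \<Rightarrow> 'mhn::complex_hilbert_space"
  assumes tMH: "is_tensor_product tMH" and tn: "is_tensor_power n tn" and tM: "is_tensor_product tM"
    and e: "orthonormal_basis e L" and V: "\<And>l. l \<in> L \<Longrightarrow> isometry_op (V l)"
  defines "W \<equiv> use_op tMH tn tM n (controlled_op tMH e L V)"
  shows "\<And>k. k < n \<Longrightarrow> bounded_clinear (W k)"
    and "\<And>l y. l \<in> L \<Longrightarrow> compose_upto W n (tM (e l) y) = tM (e l) (power_op tn (V l) y)"
proof -
  have "\<exists>A. isometry_op A \<and> (\<forall>x. A (tn x) = tn (x(k := V l (x k))))" if l: "l \<in> L" for l k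
  proof -
    have "isometry_op (if i = k then V l else (\<lambda>x. x))" for i
      using V[OF l] by (simp add: isometry_op_def bounded_clinear_id)
    then obtain A where "isometry_op A"
      "\<And>x. A (tn x) = tn (\<lambda>i. (if i = k then V l else (\<lambda>x. x)) (x i))"
      using tensor_power_isometry[OF tn, of "\<lambda>i. if i = k then V l else (\<lambda>x. x)"] by blast
    moreover have "(\<lambda>i. (if i = k then V l else (\<lambda>x. x)) (x i)) = x(k := V l (x k))" for x
      by auto
    ultimately show ?thesis by auto
  qed
  then obtain A where A: "\<And>l k. l \<in> L \<Longrightarrow> isometry_op (A l k)"
    "\<And>l k x. l \<in> L \<Longrightarrow> A l k (tn x) = tn (x(k := V l (x k)))"
    by metis
  have W: "bounded_clinear (W k)" "\<And>l y. l \<in> L \<Longrightarrow> W k (tM (e l) y) = tM (e l) (A l k y)" if "k < n" for k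
    unfolding W_def
    using use_op_controlled[where A = "\<lambda>l. A l k", OF tMH tn tM e V that A] by blast+
  show "\<And>k. k < n \<Longrightarrow> bounded_clinear (W k)"
    by (rule W(1))
  fix l y assume l: "l \<in> L"
  have "m \<le> n \<Longrightarrow> compose_upto W m (tM (e l) y) = tM (e l) (compose_upto (A l) m y)" for m
    by (induction m) (simp_all add: W(2) l)
  from this[of n] show "compose_upto W n (tM (e l) y) = tM (e l) (power_op tn (V l) y)"
    using compose_upto_power_op[OF tn V[OF l], of "A l"] A l by simp
qed

text \<open>The mixture form is carried through the three stages of the channel: tensoring,
  evolution and partial trace.\<close>

lemma memory_channel_mixture:
  fixes tMH :: "'m::complex_hilbert_space \<Rightarrow> 'h::complex_hilbert_space \<Rightarrow> 'mh::complex_hilbert_space"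
    and tn :: "(nat \<Rightarrow> 'h) \<Rightarrow> 'hn::complex_hilbert_space"
    and tM :: "'m \<Rightarrow> 'hn \<Rightarrow> 'mhn::complex_hilbert_space"
  assumes tM: "is_tensor_product tM" and W: "\<And>k. k < n \<Longrightarrow> bounded_clinear (use_op tMH tn tM n U k)"
    and v: "square_summable v I" and w: "square_summable w J"
  defines "s \<equiv> \<lambda>(b, i, j). cadjoint (tM b) (compose_upto (use_op tMH tn tM n U) n (tM (v i) (w j)))"
  shows "square_summable s (some_basis \<times> I \<times> J)"
    and "memory_channel tMH tn tM n U (mixture v I) (mixture w J) = mixture s (some_basis \<times> I \<times> J)"
proof -
  let ?u = "\<lambda>(i, j). tM (v i) (w j)" and ?F = "compose_upto (use_op tMH tn tM n U) n"
  note u = square_summable_tensor[OF tM v w]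
  note Fu = square_summable_image[OF bounded_clinear_compose_upto[of n, OF W] u]
  have s: "s = (\<lambda>(b, p). cadjoint (tM b) (?F (?u p)))"
    by (auto simp: s_def)
  show "square_summable s (some_basis \<times> I \<times> J)"
    unfolding s by (rule square_summable_partial_trace[OF tM Fu])
  show "memory_channel tMH tn tM n U (mixture v I) (mixture w J) = mixture s (some_basis \<times> I \<times> J)"
    unfolding memory_channel_def tensor_op_mixture[OF tM v w] s
      evolve_mixture[where n = n and W = "use_op tMH tn tM n U", OF u W, simplified]
    by (rule partial_trace_mixture[OF tM Fu])
qed

theorem theorem1:
  fixes tMH :: "'m::complex_hilbert_space \<Rightarrow> 'h::complex_hilbert_space \<Rightarrow> 'mh::complex_hilbert_space"
    and n :: nat
    and tn :: "(nat \<Rightarrow> 'h) \<Rightarrow> 'hn::complex_hilbert_space"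
    and tM :: "'m \<Rightarrow> 'hn \<Rightarrow> 'mhn::complex_hilbert_space"
    and e :: "'l \<Rightarrow> 'm" and L :: "'l set"
    and V :: "'l \<Rightarrow> 'h \<Rightarrow> 'h"
    and \<xi> :: "'m \<Rightarrow> 'm"
    and \<rho> E :: "'hn \<Rightarrow> 'hn"
  assumes "is_tensor_product tMH"
    and "n \<ge> 1"
    and "is_tensor_power n tn"
    and "is_tensor_product tM"
    and "orthonormal_basis e L"
    and "\<forall>l\<in>L. unitary_op (V l)"
    and "density_operator \<xi>"
    and "density_operator \<rho>"
    and "effect E"
    and "0 < trace_op (E \<circ> memory_channel tMH tn tM n (controlled_op tMH e L V) \<xi> \<rho>)"
  shows "\<exists>l\<in>L. 0 < trace_op (E \<circ> memoryless_channel tn (V l) \<rho>)"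
proof (rule ccontr)
  assume contra: "\<not> ?thesis"
  note tMH = assms(1) and tn = assms(3) and tM = assms(4) and e = assms(5)
  have V: "isometry_op (V l)" "unitary_op (V l)" if "l \<in> L" for l
    using assms(6) that unitary_isometry_op(1) by auto
  have E: "positive_op E"
    using assms(9) by (simp add: effect_def)
  note bE = positive_op_bounded_clinear[OF E]
  obtain v :: "nat \<Rightarrow> 'm" where v: "square_summable v UNIV" "\<xi> = mixture v UNIV"
    using density_operator_mixture[OF assms(7)] .
  obtain r :: "nat \<Rightarrow> 'hn" where r: "square_summable r UNIV" "\<rho> = mixture r UNIV"
    using density_operator_mixture[OF assms(8)] .
  have zero: "E (power_op tn (V l) (r j)) = 0" if l: "l \<in> L" for l j
  proof -
    let ?P = "power_op tn (V l)"
    have P: "bounded_clinear ?P"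
      by (rule isometry_op_bounded_clinear[OF power_op_isometry(1)[OF tn V(1)[OF l]]])
    note Pr = square_summable_image[OF P r(1)]
    have "memoryless_channel tn (V l) \<rho> = mixture (\<lambda>j. ?P (r j)) UNIV"
      unfolding memoryless_channel_def r(2) power_op_cadjoint[OF tn V(2)[OF l]]
      by (rule mixture_conjugate[OF P r(1) cinner_cadjoint_right[OF P]])
    then have sum: "((\<lambda>j. cinner (?P (r j)) (E (?P (r j)))) has_sum
        trace_op (E \<circ> memoryless_channel tn (V l) \<rho>)) UNIV"
      using trace_op_mixture[OF bE Pr] by simp
    have nonneg: "0 \<le> cinner x (E x)" for x
      using E by (simp add: positive_op_def)
    \<comment> \<open>In the complex order the failure of \<open>0 < z\<close> does not by itself
      give \<open>z \<le> 0\<close>; knowing \<open>0 \<le> z\<close> first leaves only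
      \<open>z = 0\<close>.\<close>
    have "0 \<le> trace_op (E \<circ> memoryless_channel tn (V l) \<rho>)"
      using infsum_nonneg_complex[OF has_sum_imp_summable[OF sum] nonneg] infsumI[OF sum] by simp
    then have "trace_op (E \<circ> memoryless_channel tn (V l) \<rho>) \<le> 0"
      using contra l by (auto simp: order.order_iff_strict)
    then have "cinner (?P (r j)) (E (?P (r j))) = 0"
      using nonneg_has_sum_le_0D_complex[OF sum] nonneg by blast
    then show ?thesis
      by (intro positive_op_eq_0[OF E]) simp
  qed
  define W where "W = use_op tMH tn tM n (controlled_op tMH e L V)"
  have W: "bounded_clinear (W k)" if "k < n" for k
    unfolding W_def by (rule controlled_device_action(1)[OF tMH tn tM e V(1) that])
  have action: "compose_upto W n (tM (e l) y) = tM (e l) (power_op tn (V l) y)" if "l \<in> L" for l y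
    unfolding W_def by (rule controlled_device_action(2)[OF tMH tn tM e V(1) that])
  note F = bounded_clinear_compose_upto[of n W, OF W]
  have E0: "E (cadjoint (tM b) (compose_upto W n (tM m (r j)))) = 0" for b m j
  proof (rule bounded_clinear_zero_on_dense[OF _ orthonormal_basis_dense[OF e]])
    have J: "bounded_clinear (cadjoint (tM b))"
      by (rule bounded_clinear_cadjoint[OF bounded_clinear_tensor_right[OF tM]])
    show "bounded_clinear (\<lambda>m. E (cadjoint (tM b) (compose_upto W n (tM m (r j)))))"
      by (intro bounded_clinear_compose[OF bE] bounded_clinear_compose[OF J]
          bounded_clinear_compose[OF F] bounded_clinear_tensor_left[OF tM])
    fix m assume "m \<in> e ` L"
    then obtain l where l: "l \<in> L" "m = e l" by auto
    show "E (cadjoint (tM b) (compose_upto W n (tM m (r j)))) = 0"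
      \<comment> \<open>Contracting with \<open>b\<close> leaves the scalar
        \<open>cinner b (e l)\<close> times a vector that \<open>E\<close> annihilates by
        \<open>zero\<close>.\<close>
      by (simp add: l action cadjoint_tensor[OF tM] bounded_clinear_scaleC[OF bE] zero)
  qed
  define s where "s = (\<lambda>(b, i, j). cadjoint (tM b) (compose_upto W n (tM (v i) (r j))))"
  note memory = memory_channel_mixture[where n = n and tMH = tMH and tn = tn
      and U = "controlled_op tMH e L V", OF tM _ v(1) r(1), folded W_def, folded s_def v(2) r(2), OF W]
  have "E (s p) = 0" for p
    by (cases p) (simp add: s_def E0)
  then have "trace_op (E \<circ> memory_channel tMH tn tM n (controlled_op tMH e L V) \<xi> \<rho>) = 0"
    using has_sum_unique[OF trace_op_mixture[OF bE memory(1)], of 0] by (simp add: memory(2))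
  then show False
    using assms(10) by simp
qed

end
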